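(* Fix $k\ge 2$, and let $G$ be a protected (not necessarily reflexive) directed graph with cop number $c(G)=k$ such that every vertex of $G$ has at least one in-neighbor and at least one out-neighbor. Let $H$ be the protected reflexive undirected graph constructed from $G$ as in the context. Then $c(H)=k$ and $\mathrm{capt}(G)+1\le \mathrm{capt}(H)\le \mathrm{capt}(G)+2$. In addition, $|V(H)|=(3k+3)|V(G)|+8k+3$.
   Context: Protected game: the board is a graph (directed or undirected) in which every edge, including loops, is labeled protected or unprotected. The cops first choose starting vertices, then the robber does; then the game proceeds in rounds, each consisting of a cop turn (every cop traverses an edge incident to/out of her current vertex, following directions in the directed case; staying put is possible only by traversing a loop) followed by a robber turn (the robber does likewise). The cops win if some cop arrives at the robber's vertex by traversing an unprotected edge (possibly an unprotected loop); in particular the robber may move onto a cop's vertex without being captured. The cop number $c(\cdot)$ is the least number of cops that can guarantee a win. The capture time $\mathrm{capt}(\cdot)$ is the least $t$ such that $c(\cdot)$ cops can always capture the robber within $t$ rounds regardless of the robber's play (choosing initial positions is not a round; the first round begins with the first cop turn). Construction of $H$ from a protected directed graph $G$ with $k=c(G)$ (indices $i$ on $C_i,R_i,T_i$ taken mod 3, indices on $s$ taken mod $4k$, lower indices on $t$ mod $k$): the vertex set of $H$ is the disjoint union of $S=\{s_0,\dots,s_{4k-1}\}$, $T_i=\{t^i_0,\dots,t^i_{k-1}\}$ for $i\in\{0,1,2\}$ ($S\cup T_0\cup T_1\cup T_2$ is the reset clique), $C_i=\{\kappa(v;i,j): v\in V(G), 0\le j\le k-1\}$, $R_i=\{\rho(v;i):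 v\in V(G)\}$, $C^*=\{c^*_0,\dots,c^*_{k-1}\}$, and $R^*=\{r^*_0,r^*_1,r^*_2\}$. Edges of $H$ (undirected): every vertex has a loop, protected for vertices of the reset clique and unprotected otherwise; protected edges between every two distinct vertices of the reset clique; unprotected edges $\kappa(v;i,j)\kappa(v;i,j')$ for $j\ne j'$; for each directed edge $\overrightarrow{uv}$ of $G$ ($u=v$ allowed) and all $i,j$, unprotected edges $\kappa(u;i,j)\kappa(v;i+1,j)$ and $\rho(u;i)\rho(v;i+1)$, and additionally the unprotected edge $\kappa(u;i,j)\rho(v;i+1)$ if $\overrightarrow{uv}$ is unprotected; protected edges from each vertex of $R_i$ to each vertex of $S\cup T_i$; unprotected edges from $\kappa(v;i,j)$ to $s_{4j+i},s_{4j+i+1},s_{4j+i+2},s_{4j+i+3}$ and $t^i_j$; unprotected edges from every vertex of $C_i$ to every vertex of $R_i\cup R_{i-1}$; unprotected edges from $c^*_j$ to $s_{4j+3},s_{4j+4},s_{4j+5},s_{4j+6},t^0_j,t^1_j,t^2_j$; unprotected edges from every vertex of $C^*$ to every vertex of $C_0\cup C_1\cup C_2\cup R_0\cup R_1\cup R_2$; unprotected edges from every vertex of $R^*$ to every vertex of $C_0\cup C_1\cup C_2$; unprotected edges from $r^*_i$ to every vertex of $R_{i+1}$; protected edges between each pair of vertices of $R^*$; protected edges from $r^*_i$ to every vertex of $S\cup T_i$. No other edges. *)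

theory Defs
  imports "HOL-Library.Extended_Nat"
begin

section \<open>Protected graphs\<close>

text \<open>
  Loops are pairs \<open>(v, v)\<close>. An undirected graph is represented by the directed graph that
  contains both orientations of each of its edges, with equal labels.
\<close>

record 'a pgraph =
  verts :: "'a set"
  prot :: "('a \<times> 'a) set"
  unprot :: "('a \<times> 'a) set"

definition edges :: "'a pgraph \<Rightarrow> ('a \<times> 'a) set" where
  "edges G = prot G \<union> unprot G"

definition protected_digraph :: "'a pgraph \<Rightarrow> bool" where
  "protected_digraph G \<longleftrightarrow>
     finite (verts G) \<and> edges G \<subseteq> verts G \<times> verts G \<and> prot G \<inter> unprot G = {}"

definition undirected :: "'a pgraph \<Rightarrow> bool" where
  "undirected G \<longleftrightarrow> sym (prot G) \<and> sym (unprot G)"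

definition reflexive :: "'a pgraph \<Rightarrow> bool" where
  "reflexive G \<longleftrightarrow> (\<forall>v \<in> verts G. (v, v) \<in> edges G)"


section \<open>The protected game\<close>

text \<open>
  The value \<open>r 0\<close> is the starting vertex of the robber and \<open>r (Suc n)\<close> his vertex at the end of
  the round with index \<open>n\<close>; rounds are indexed from 0.

  A strategy for the cops maps the sequence of robber positions seen so far to the vertices of
  the cops, of which only the values at indices below the number of cops matter: \<open>\<sigma> []\<close> is the
  initial placement and \<open>\<sigma> [r 0, \<dots>, r n]\<close> the placement after the cop turn of the round with
  index \<open>n\<close>. The history of the cops' own moves is determined by \<open>\<sigma>\<close> and the robber's history,
  and quantifying over all robber walks covers robbers who react to the moves of the cops.

  The moves of a robber walk past a capture are irrelevant, as the cops' moves are constrained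
  only until the capture. Walks are infinite, so a robber who runs into a vertex without an
  out-neighbour is disregarded; no such vertex exists in the graphs considered below.
\<close>

type_synonym 'a strategy = "'a list \<Rightarrow> nat \<Rightarrow> 'a"

definition robber_walk :: "'a pgraph \<Rightarrow> (nat \<Rightarrow> 'a) \<Rightarrow> bool" where
  "robber_walk G r \<longleftrightarrow> r 0 \<in> verts G \<and> (\<forall>n. (r n, r (Suc n)) \<in> edges G)"

definition cops_at :: "'a strategy \<Rightarrow> (nat \<Rightarrow> 'a) \<Rightarrow> nat \<Rightarrow> nat \<Rightarrow> 'a" where
  "cops_at \<sigma> r n = \<sigma> (map r [0..<n])"

text \<open>In the cop turn of the round with index \<open>n\<close> the robber stands on \<open>r n\<close>.\<close>

definition capture_at :: "'a pgraph \<Rightarrow> nat \<Rightarrow> 'a strategy \<Rightarrow> (nat \<Rightarrow> 'a) \<Rightarrow> nat \<Rightarrow> bool" where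
  "capture_at G k \<sigma> r n \<longleftrightarrow>
     (\<exists>j<k. cops_at \<sigma> r (Suc n) j = r n \<and>
            (cops_at \<sigma> r n j, cops_at \<sigma> r (Suc n) j) \<in> unprot G)"

definition legal_strategy :: "'a pgraph \<Rightarrow> nat \<Rightarrow> 'a strategy \<Rightarrow> bool" where
  "legal_strategy G k \<sigma> \<longleftrightarrow>
     (\<forall>j<k. \<sigma> [] j \<in> verts G) \<and>
     (\<forall>r n. robber_walk G r \<and> (\<forall>m<n. \<not> capture_at G k \<sigma> r m) \<longrightarrow>
        (\<forall>j<k. (cops_at \<sigma> r n j, cops_at \<sigma> r (Suc n) j) \<in> edges G))"

definition cops_win :: "'a pgraph \<Rightarrow> nat \<Rightarrow> bool" where
  "cops_win G k \<longleftrightarrow>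
     (\<exists>\<sigma>. legal_strategy G k \<sigma> \<and> (\<forall>r. robber_walk G r \<longrightarrow> (\<exists>n. capture_at G k \<sigma> r n)))"

definition cops_win_within :: "'a pgraph \<Rightarrow> nat \<Rightarrow> nat \<Rightarrow> bool" where
  "cops_win_within G k t \<longleftrightarrow>
     (\<exists>\<sigma>. legal_strategy G k \<sigma> \<and> (\<forall>r. robber_walk G r \<longrightarrow> (\<exists>n<t. capture_at G k \<sigma> r n)))"

text \<open>
  The cop number of a protected graph may be infinite, e.g. if all edges are protected.
\<close>

definition cop_number :: "'a pgraph \<Rightarrow> enat" where
  "cop_number G = (INF k \<in> {k. cops_win G k}. enat k)"

text \<open>Meaningful only if the cop number is finite; on a finite graph it is then finite as well.\<close>

definition capture_time :: "'a pgraph \<Rightarrow> enat" where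
  "capture_time G = (INF t \<in> {t. cops_win_within G (the_enat (cop_number G)) t}. enat t)"


section \<open>The construction of \<open>H\<close>\<close>

datatype 'a hvert =
    SV nat
  | TV nat nat      \<comment> \<open>\<open>TV i j\<close> is $t^i_j$\<close>
  | Kappa 'a nat nat
  | Rho 'a nat
  | CStar nat
  | RStar nat

definition S_set :: "nat \<Rightarrow> 'a hvert set" where
  "S_set k = {SV l | l. l < 4 * k}"

definition T_set :: "nat \<Rightarrow> nat \<Rightarrow> 'a hvert set" where
  "T_set k i = {TV i j | j. j < k}"

definition C_set :: "'a pgraph \<Rightarrow> nat \<Rightarrow> nat \<Rightarrow> 'a hvert set" where
  "C_set G k i = {Kappa v i j | v j. v \<in> verts G \<and> j < k}"

definition R_set :: "'a pgraph \<Rightarrow> nat \<Rightarrow> 'a hvert set" where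
  "R_set G i = {Rho v i | v. v \<in> verts G}"

definition CStar_set :: "nat \<Rightarrow> 'a hvert set" where
  "CStar_set k = {CStar j | j. j < k}"

definition RStar_set :: "'a hvert set" where
  "RStar_set = {RStar i | i. i < 3}"

definition reset_clique :: "nat \<Rightarrow> 'a hvert set" where
  "reset_clique k = S_set k \<union> (\<Union>i<3. T_set k i)"

definition H_verts :: "'a pgraph \<Rightarrow> nat \<Rightarrow> 'a hvert set" where
  "H_verts G k =
     reset_clique k \<union> (\<Union>i<3. C_set G k i) \<union> (\<Union>i<3. R_set G i) \<union> CStar_set k \<union> RStar_set"

text \<open>
  In the next two definitions each edge is listed in at least one orientation. The square of the
  reset clique contains its loops.
\<close>

definition H_prot_base :: "'a pgraph \<Rightarrow> nat \<Rightarrow> ('a hvert \<times> 'a hvert) set" where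
  "H_prot_base G k =
     reset_clique k \<times> reset_clique k
   \<union> (\<Union>i<3. R_set G i \<times> (S_set k \<union> T_set k i))
   \<union> {(RStar i, RStar i') | i i'. i < 3 \<and> i' < 3 \<and> i \<noteq> i'}
   \<union> (\<Union>i<3. {RStar i} \<times> (S_set k \<union> T_set k i))"

definition H_unprot_base :: "'a pgraph \<Rightarrow> nat \<Rightarrow> ('a hvert \<times> 'a hvert) set" where
  "H_unprot_base G k =
     {(x, x) | x. x \<in> H_verts G k - reset_clique k}
   \<union> {(Kappa v i j, Kappa v i j') | v i j j'.
        v \<in> verts G \<and> i < 3 \<and> j < k \<and> j' < k \<and> j \<noteq> j'}
   \<union> {(Kappa u i j, Kappa v ((i + 1) mod 3) j) | u v i j.
        (u, v) \<in> edges G \<and> i < 3 \<and> j < k}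
   \<union> {(Rho u i, Rho v ((i + 1) mod 3)) | u v i. (u, v) \<in> edges G \<and> i < 3}
   \<union> {(Kappa u i j, Rho v ((i + 1) mod 3)) | u v i j.
        (u, v) \<in> unprot G \<and> i < 3 \<and> j < k}
   \<union> {(Kappa v i j, SV ((4 * j + i + d) mod (4 * k))) | v i j d.
        v \<in> verts G \<and> i < 3 \<and> j < k \<and> d \<in> {0, 1, 2, 3}}
   \<union> {(Kappa v i j, TV i j) | v i j. v \<in> verts G \<and> i < 3 \<and> j < k}
   \<union> (\<Union>i<3. C_set G k i \<times> (R_set G i \<union> R_set G ((i + 2) mod 3)))
   \<union> {(CStar j, SV ((4 * j + d) mod (4 * k))) | j d. j < k \<and> d \<in> {3, 4, 5, 6}}
   \<union> {(CStar j, TV i j) | i j. i < 3 \<and> j < k}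
   \<union> CStar_set k \<times> ((\<Union>i<3. C_set G k i) \<union> (\<Union>i<3. R_set G i))
   \<union> RStar_set \<times> (\<Union>i<3. C_set G k i)
   \<union> (\<Union>i<3. {RStar i} \<times> R_set G ((i + 1) mod 3))"

definition H_graph :: "'a pgraph \<Rightarrow> nat \<Rightarrow> 'a hvert pgraph" where
  "H_graph G k =
     \<lparr> verts = H_verts G k,
       prot = H_prot_base G k \<union> (H_prot_base G k)\<inverse>,
       unprot = H_unprot_base G k \<union> (H_unprot_base G k)\<inverse> \<rparr>"

lemmas H_set_defs =
  S_set_def T_set_def C_set_def R_set_def CStar_set_def RStar_set_def reset_clique_def H_verts_def

lemma undirected_H_graph: "undirected (H_graph G k)"
  by (auto simp: undirected_def H_graph_def intro: sym_Un_converse)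

lemma reflexive_H_graph: "reflexive (H_graph G k)"
  by (auto simp: reflexive_def edges_def H_graph_def H_prot_base_def H_unprot_base_def)

lemma finite_H_verts:
  fixes G :: "'a pgraph"
  assumes "finite (verts G)"
  shows "finite (H_verts G k)"
proof -
  have "(S_set k :: 'a hvert set) = SV ` {..<4 * k}"
    "(T_set k i :: 'a hvert set) = TV i ` {..<k}"
    "C_set G k i = (\<lambda>(v, j). Kappa v i j) ` (verts G \<times> {..<k})"
    "R_set G i = (\<lambda>v. Rho v i) ` verts G"
    "(CStar_set k :: 'a hvert set) = CStar ` {..<k}" for i
    by (auto simp: H_set_defs)
  moreover have "finite (RStar_set :: 'a hvert set)"
    by (simp add: RStar_set_def)
  ultimately show ?thesis
    using assms by (simp add: H_verts_def reset_clique_def)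
qed

lemma H_labels_disjoint:
  "(H_prot_base G k \<union> (H_prot_base G k)\<inverse>) \<inter> (H_unprot_base G k \<union> (H_unprot_base G k)\<inverse>) = {}"
proof -
  define \<kappa> :: "'a hvert \<Rightarrow> nat" where
    "\<kappa> x = (case x of SV _ \<Rightarrow> 0 | TV _ _ \<Rightarrow> 0 | Kappa _ _ _ \<Rightarrow> 1 | CStar _ \<Rightarrow> 1
                     | Rho _ _ \<Rightarrow> 2 | RStar _ \<Rightarrow> 3)" for x
  define D where
    "D = {(x, y). \<kappa> x = 0 \<and> \<kappa> y = 0 \<or> \<kappa> x \<noteq> 1 \<and> \<kappa> y = 0 \<or> \<kappa> x = 0 \<and> \<kappa> y \<noteq> 1
                \<or> \<kappa> x = 3 \<and> \<kappa> y = 3 \<and> x \<noteq> y}"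
  have "sym D"
    by (auto simp: D_def sym_def)
  have "H_prot_base G k \<subseteq> D"
    unfolding H_prot_base_def
    by (intro Un_least UN_least) (auto simp: D_def \<kappa>_def H_set_defs)
  moreover have "H_unprot_base G k \<subseteq> - D"
    unfolding H_unprot_base_def
    by (intro Un_least UN_least) (auto simp: D_def \<kappa>_def H_set_defs)
  ultimately show ?thesis
    using \<open>sym D\<close> by (blast dest: symD)
qed

lemma H_edges_subset:
  assumes "protected_digraph G"
  shows "H_prot_base G k \<union> H_unprot_base G k \<subseteq> H_verts G k \<times> H_verts G k"
proof -
  have E: "u \<in> verts G \<and> v \<in> verts G" if "(u, v) \<in> edges G" for u v
    using assms that by (auto simp: protected_digraph_def)
  have U: "u \<in> verts G \<and> v \<in> verts G" if "(u, v) \<in> unprot G" for u v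
    using E that by (auto simp: edges_def)
  show ?thesis
    unfolding H_prot_base_def H_unprot_base_def
    by (intro Un_least UN_least) (auto simp: H_set_defs dest: E U)
qed

lemma protected_digraph_H_graph:
  assumes "protected_digraph G"
  shows "protected_digraph (H_graph G k)"
proof -
  have "finite (verts G)"
    using assms by (simp add: protected_digraph_def)
  then show ?thesis
    using finite_H_verts[of G k] H_labels_disjoint[of G k] H_edges_subset[OF assms, of k]
    unfolding protected_digraph_def H_graph_def edges_def pgraph.simps by blast
qed

end

theory Submission
  imports Defs
begin

text \<open>
  Upper bound: the cops start on \<open>C*\<close>, which attacks everything but \<open>R*\<close>. If the robber stands on
  \<open>r*_i\<close>, they move to copies in \<open>C_i\<close> of a winning initial placement in \<open>G\<close>, and from then on the
  cops in \<open>C_i\<close> and the robber in \<open>R_{i+1}\<close> play the game of \<open>G\<close>, the index \<open>i\<close> advancing in each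
  round. The only safe deviation of the robber is a move into some \<open>C_m\<close>, which costs the cops at
  most one additional round.

  Lower bound: \<open>S\<close> is a cycle of \<open>4 k\<close> points of which each cop attacks at most an interval of
  length 4, at an offset modulo 4 that tells which of \<open>C_0, C_1, C_2, C*\<close> she is in. Hence the robber
  can retreat to \<open>S\<close> unless all \<open>k\<close> cops are in the same \<open>C_i\<close> or all are in \<open>C*\<close>. If they are in
  \<open>C_i\<close>, then the \<open>T_m\<close> with \<open>m \<noteq> i\<close> remain safe; if they are in \<open>C*\<close>, he goes to \<open>R*\<close>. So he can
  be forced only into the game of \<open>G\<close>, which the cops enter after a preliminary round.
\<close>

section \<open>Bounded games\<close>

text \<open>The game solved backwards: whether the cops can win in the rounds left depends only on
  the position with the cops to move, so strategies over histories are traded for a recursion on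
  positions.\<close>

primrec cops_force :: "'a pgraph \<Rightarrow> nat \<Rightarrow> nat \<Rightarrow> (nat \<Rightarrow> 'a) \<Rightarrow> 'a \<Rightarrow> bool" where
  "cops_force G k 0 c r \<longleftrightarrow> False"
| "cops_force G k (Suc t) c r \<longleftrightarrow>
     (\<exists>c'. (\<forall>j<k. (c j, c' j) \<in> edges G) \<and>
           ((\<exists>j<k. c' j = r \<and> (c j, r) \<in> unprot G) \<or>
            (\<forall>r'. (r, r') \<in> edges G \<longrightarrow> cops_force G k t c' r')))"

lemma cops_force_Suc: "cops_force G k t c r \<Longrightarrow> cops_force G k (Suc t) c r"
proof (induction t arbitrary: c r)
  case (Suc t)
  then obtain c' where "\<forall>j<k. (c j, c' j) \<in> edges G"
    "(\<exists>j<k. c' j = r \<and> (c j, r) \<in> unprot G) \<or>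
      (\<forall>r'. (r, r') \<in> edges G \<longrightarrow> cops_force G k t c' r')"
    by auto
  with Suc.IH show ?case
    by (subst cops_force.simps) (intro exI[of _ c'], blast)
qed simp

lemma cops_force_mono: "t \<le> t' \<Longrightarrow> cops_force G k t c r \<Longrightarrow> cops_force G k t' c r"
  by (induction rule: dec_induct) (auto simp del: cops_force.simps intro: cops_force_Suc)

lemma cops_force_capture:
  assumes "j < k" "(c j, r) \<in> unprot G" "\<And>j. j < k \<Longrightarrow> \<exists>w. (c j, w) \<in> edges G"
  shows "cops_force G k (Suc t) c r"
proof -
  obtain w where w: "\<And>j. j < k \<Longrightarrow> (c j, w j) \<in> edges G"
    using assms(3) by metis
  show ?thesis
    unfolding cops_force.simps
  proof (intro exI conjI disjI1)
    show "\<forall>i<k. (c i, (w(j := r)) i) \<in> edges G"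
      using assms(2) w by (simp add: edges_def)
  qed (use assms(1,2) in auto)
qed

section \<open>Strategies and positions won in bounded time\<close>

definition legal_from :: "'a pgraph \<Rightarrow> nat \<Rightarrow> 'a strategy \<Rightarrow> 'a \<Rightarrow> bool" where
  "legal_from G k \<sigma> v \<longleftrightarrow>
     (\<forall>r n. robber_walk G r \<and> r 0 = v \<and> (\<forall>m<n. \<not> capture_at G k \<sigma> r m) \<longrightarrow>
        (\<forall>j<k. (cops_at \<sigma> r n j, cops_at \<sigma> r (Suc n) j) \<in> edges G))"

lemma legal_strategy_iff:
  "legal_strategy G k \<sigma> \<longleftrightarrow>
     (\<forall>j<k. \<sigma> [] j \<in> verts G) \<and> (\<forall>v \<in> verts G. legal_from G k \<sigma> v)"
  unfolding legal_strategy_def legal_from_def robber_walk_def by blast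

lemma cops_at_0 [simp]: "cops_at \<sigma> r 0 = \<sigma> []"
  by (simp add: cops_at_def)

text \<open>Peeling off the first round leaves the shifted walk and the strategy with
  \<open>r 0\<close> prefixed to every history. The inductions over rounds rest on this
  shift.\<close>

lemma cops_at_Suc: "cops_at \<sigma> r (Suc n) = cops_at (\<lambda>h. \<sigma> (r 0 # h)) (\<lambda>n. r (Suc n)) n"
proof -
  have "[0..<Suc n] = 0 # map Suc [0..<n]"
    by (simp add: upt_conv_Cons map_Suc_upt del: upt_Suc)
  then show ?thesis
    by (simp add: cops_at_def comp_def del: upt_Suc)
qed

lemma capture_at_0:
  "capture_at G k \<sigma> r 0 \<longleftrightarrow> (\<exists>j<k. \<sigma> [r 0] j = r 0 \<and> (\<sigma> [] j, r 0) \<in> unprot G)"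
  by (auto simp: capture_at_def cops_at_Suc)

lemma capture_at_Suc:
  "capture_at G k \<sigma> r (Suc n) \<longleftrightarrow>
     capture_at G k (\<lambda>h. \<sigma> (r 0 # h)) (\<lambda>n. r (Suc n)) n"
  by (simp add: capture_at_def cops_at_Suc[of \<sigma>])

locale endless_graph =
  fixes G :: "'a pgraph"
  assumes digraph: "protected_digraph G"
    and out_neighbour: "v \<in> verts G \<Longrightarrow> \<exists>w. (v, w) \<in> edges G"
begin

lemma edge_verts: "(u, v) \<in> edges G \<Longrightarrow> u \<in> verts G \<and> v \<in> verts G"
  using digraph by (auto simp: protected_digraph_def)

text \<open>Strategies are constrained along infinite walks only; iterating a choice of
  out-neighbours turns any position into the start of one.\<close>

lemma walk_exists:
  assumes "v \<in> verts G"
  obtains r where "robber_walk G r" "r 0 = v"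
proof -
  obtain s where s: "\<And>v. v \<in> verts G \<Longrightarrow> (v, s v) \<in> edges G"
    using out_neighbour by metis
  have "(s ^^ n) v \<in> verts G" for n
    by (induction n) (use assms s edge_verts in auto)
  then have "robber_walk G (\<lambda>n. (s ^^ n) v)"
    using s assms by (simp add: robber_walk_def)
  then show thesis
    using that by force
qed

lemma robber_walk_case_nat:
  "(v, r 0) \<in> edges G \<Longrightarrow> robber_walk G r \<Longrightarrow> robber_walk G (case_nat v r)"
  using edge_verts by (auto simp: robber_walk_def split: nat.split)

lemma robber_walk_tail:
  "robber_walk G r \<Longrightarrow> robber_walk G (\<lambda>n. r (Suc n))"
  using edge_verts by (auto simp: robber_walk_def)

lemma legal_from_first:
  assumes "legal_from G k \<sigma> v" "v \<in> verts G" "j < k"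
  shows "(\<sigma> [] j, \<sigma> [v] j) \<in> edges G"
proof -
  obtain r where "robber_walk G r" "r 0 = v"
    using walk_exists assms(2) .
  then show ?thesis
    using assms unfolding legal_from_def
    by (metis cops_at_0 cops_at_Suc not_less_zero)
qed

text \<open>\<open>legal_from\<close> fixes the start of the robber and leaves the placement of the
  cops free, so it passes to the strategy after the first round. A capture in that round is excluded
  because legality says nothing about the moves after it.\<close>

lemma legal_from_tail:
  assumes "legal_from G k \<sigma> v" "(v, w) \<in> edges G"
    "\<not> (\<exists>j<k. \<sigma> [v] j = v \<and> (\<sigma> [] j, v) \<in> unprot G)"
  shows "legal_from G k (\<lambda>h. \<sigma> (v # h)) w"
  unfolding legal_from_def
proof (intro allI impI)
  fix r n j
  assume *: "robber_walk G r \<and> r 0 = w \<and> (\<forall>m<n. \<not> capture_at G k (\<lambda>h. \<sigma> (v # h)) r m)"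
    and "j < k"
  let ?r = "case_nat v r"
  have "robber_walk G ?r"
    using * assms(2) by (intro robber_walk_case_nat) auto
  moreover have "\<not> capture_at G k \<sigma> ?r m" if "m < Suc n" for m
    using that * assms(3) by (cases m) (auto simp: capture_at_0 capture_at_Suc)
  ultimately have "(cops_at \<sigma> ?r (Suc n) j, cops_at \<sigma> ?r (Suc (Suc n)) j) \<in> edges G"
    using assms(1) \<open>j < k\<close> unfolding legal_from_def by (metis nat.case(1))
  then show "(cops_at (\<lambda>h. \<sigma> (v # h)) r n j, cops_at (\<lambda>h. \<sigma> (v # h)) r (Suc n) j) \<in> edges G"
    by (simp add: cops_at_Suc[of \<sigma>])
qed

lemma strategy_imp_cops_force:
  assumes "legal_from G k \<sigma> v" "v \<in> verts G"
    "\<And>r. robber_walk G r \<Longrightarrow> r 0 = v \<Longrightarrow> \<exists>n<t. capture_at G k \<sigma> r n"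
  shows "cops_force G k t (\<sigma> []) v"
  using assms
proof (induction t arbitrary: \<sigma> v)
  case 0
  obtain r where "robber_walk G r" "r 0 = v"
    using walk_exists 0(2) .
  then show ?case
    using 0(3) by blast
next
  case (Suc t)
  show ?case
  proof (cases "\<exists>j<k. \<sigma> [v] j = v \<and> (\<sigma> [] j, v) \<in> unprot G")
    case True
    then show ?thesis
      using legal_from_first[OF Suc.prems(1,2)] by auto
  next
    case False
    have "cops_force G k t (\<sigma> [v]) w" if w: "(v, w) \<in> edges G" for w
    proof (rule Suc.IH[of "\<lambda>h. \<sigma> (v # h)"])
      show "legal_from G k (\<lambda>h. \<sigma> (v # h)) w"
        using legal_from_tail Suc.prems(1) w False by blast
      show "w \<in> verts G"
        using w edge_verts by blast
      fix r assume r: "robber_walk G r" "r 0 = w"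
      then have "robber_walk G (case_nat v r)"
        using w robber_walk_case_nat by blast
      then obtain n where n: "n < Suc t" "capture_at G k \<sigma> (case_nat v r) n"
        using Suc.prems(3) by force
      moreover have "n \<noteq> 0"
        using n False by (intro notI) (auto simp: capture_at_0)
      ultimately show "\<exists>n<t. capture_at G k (\<lambda>h. \<sigma> (v # h)) r n"
        by (cases n) (auto simp: capture_at_Suc)
    qed
    then show ?thesis
      using legal_from_first[OF Suc.prems(1,2)] by auto
  qed
qed

text \<open>A witness for the recursion of \<open>cops_force\<close>; \<open>t\<close> counts the
  rounds left including the present one, hence \<open>t - 1\<close>.\<close>

definition next_cops :: "nat \<Rightarrow> nat \<Rightarrow> (nat \<Rightarrow> 'a) \<Rightarrow> 'a \<Rightarrow> nat \<Rightarrow> 'a" where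
  "next_cops k t c r =
     (SOME c'. (\<forall>j<k. (c j, c' j) \<in> edges G) \<and>
           ((\<exists>j<k. c' j = r \<and> (c j, r) \<in> unprot G) \<or>
            (\<forall>r'. (r, r') \<in> edges G \<longrightarrow> cops_force G k (t - 1) c' r')))"

text \<open>The history is read from its beginning while the cops' position and the number of rounds
  left are updated; no other memory is kept.\<close>

primrec force_strategy :: "nat \<Rightarrow> 'a list \<Rightarrow> nat \<Rightarrow> (nat \<Rightarrow> 'a) \<Rightarrow> nat \<Rightarrow> 'a" where
  "force_strategy k [] t c = c"
| "force_strategy k (r # h) t c = force_strategy k h (t - 1) (next_cops k t c r)"

lemma next_cops:
  assumes "cops_force G k (Suc t) c r"
  shows "\<And>j. j < k \<Longrightarrow> (c j, next_cops k (Suc t) c r j) \<in> edges G"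
    "(\<exists>j<k. next_cops k (Suc t) c r j = r \<and> (c j, r) \<in> unprot G) \<or>
     (\<forall>r'. (r, r') \<in> edges G \<longrightarrow> cops_force G k t (next_cops k (Suc t) c r) r')"
  using someI_ex[OF assms[unfolded cops_force.simps]] unfolding next_cops_def by auto

lemma force_strategy_wins:
  assumes "cops_force G k t c (r 0)" "robber_walk G r"
  shows "\<exists>n<t. capture_at G k (\<lambda>h. force_strategy k h t c) r n"
  using assms
proof (induction t arbitrary: c r)
  case (Suc t)
  have "(r 0, r (Suc 0)) \<in> edges G"
    using Suc.prems(2) by (simp add: robber_walk_def)
  with next_cops(2)[OF Suc.prems(1)]
  consider "capture_at G k (\<lambda>h. force_strategy k h (Suc t) c) r 0"
    | "cops_force G k t (next_cops k (Suc t) c (r 0)) (r (Suc 0))"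
    by (auto simp: capture_at_0)
  then show ?case
  proof cases
    case 2
    with Suc.IH[of _ "\<lambda>n. r (Suc n)"] robber_walk_tail[OF Suc.prems(2)]
    obtain n where "n < t"
      "capture_at G k (\<lambda>h. force_strategy k h t (next_cops k (Suc t) c (r 0))) (\<lambda>n. r (Suc n)) n"
      by auto
    then show ?thesis
      by (intro exI[of _ "Suc n"]) (simp add: capture_at_Suc)
  qed auto
qed simp

lemma force_strategy_legal:
  assumes "cops_force G k t c (r 0)" "robber_walk G r"
    "\<forall>m<n. \<not> capture_at G k (\<lambda>h. force_strategy k h t c) r m" "j < k"
  shows "(cops_at (\<lambda>h. force_strategy k h t c) r n j,
          cops_at (\<lambda>h. force_strategy k h t c) r (Suc n) j) \<in> edges G"
  using assms
proof (induction n arbitrary: t c r)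
  case 0
  then show ?case
    by (cases t) (auto simp: cops_at_Suc next_cops simp del: cops_force.simps(2))
next
  case (Suc n)
  from Suc.prems(1) obtain t' where t: "t = Suc t'"
    by (cases t) auto
  have "(r 0, r (Suc 0)) \<in> edges G"
    using Suc.prems(2) by (simp add: robber_walk_def)
  moreover have "\<not> capture_at G k (\<lambda>h. force_strategy k h t c) r 0"
    using Suc.prems(3) by blast
  ultimately have "cops_force G k t' (next_cops k t c (r 0)) (r (Suc 0))"
    using next_cops(2)[OF Suc.prems(1)[unfolded t]] by (auto simp: capture_at_0 t)
  moreover have "\<forall>m<n. \<not> capture_at G k (\<lambda>h. force_strategy k h t' (next_cops k t c (r 0)))
      (\<lambda>n. r (Suc n)) m"
    using Suc.prems(3) by (auto simp: capture_at_Suc t)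
  ultimately show ?case
    using Suc.IH[of t' _ "\<lambda>n. r (Suc n)"] robber_walk_tail[OF Suc.prems(2)] Suc.prems(4)
    by (simp add: cops_at_Suc[of "\<lambda>h. force_strategy k h (Suc t') c"] t)
qed

text \<open>A strategy yields won positions by induction on the rounds; conversely, the chosen
  witnesses \<open>next_cops\<close> form a strategy. This removes strategies from the analysis of
  bounded games.\<close>

lemma cops_win_within_iff:
  "cops_win_within G k t \<longleftrightarrow>
     (\<exists>c. (\<forall>j<k. c j \<in> verts G) \<and> (\<forall>r \<in> verts G. cops_force G k t c r))"
proof
  assume "cops_win_within G k t"
  then obtain \<sigma> where \<sigma>: "legal_strategy G k \<sigma>"
    "\<And>r. robber_walk G r \<Longrightarrow> \<exists>n<t. capture_at G k \<sigma> r n"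
    unfolding cops_win_within_def by blast
  then have "\<forall>r \<in> verts G. cops_force G k t (\<sigma> []) r"
    by (intro ballI strategy_imp_cops_force) (auto simp: legal_strategy_iff)
  with \<sigma>(1) show "\<exists>c. (\<forall>j<k. c j \<in> verts G) \<and> (\<forall>r \<in> verts G. cops_force G k t c r)"
    by (auto simp: legal_strategy_iff)
next
  assume "\<exists>c. (\<forall>j<k. c j \<in> verts G) \<and> (\<forall>r \<in> verts G. cops_force G k t c r)"
  then obtain c where c: "\<forall>j<k. c j \<in> verts G" "\<forall>r \<in> verts G. cops_force G k t c r"
    by blast
  have "legal_strategy G k (\<lambda>h. force_strategy k h t c)"
    using c by (auto simp: legal_strategy_iff legal_from_def intro: force_strategy_legal)
  moreover have "\<exists>n<t. capture_at G k (\<lambda>h. force_strategy k h t c) r n" if "robber_walk G r" for r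
    using c that by (intro force_strategy_wins) (auto simp: robber_walk_def)
  ultimately show "cops_win_within G k t"
    unfolding cops_win_within_def by blast
qed

section \<open>On finite graphs, winning implies winning in bounded time\<close>

lemma uniform_bound:
  assumes "finite A" "\<And>r. r \<in> A \<Longrightarrow> \<exists>t. cops_force G k t c r"
  obtains t where "\<And>r. r \<in> A \<Longrightarrow> cops_force G k t c r"
proof -
  obtain f where f: "\<And>r. r \<in> A \<Longrightarrow> cops_force G k (f r) c r"
    using assms(2) by metis
  then show thesis
    using that[of "Max (f ` A)"] cops_force_mono assms(1) by (meson Max_ge finite_imageI image_eqI)
qed

text \<open>The step of a Koenig argument: the robber has finitely many replies, so if each were
  lost in bounded time, there would be a common bound and one more round would win from
  \<open>v\<close>.\<close>

lemma legal_not_force_step: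
  assumes "legal_from G k \<sigma> v" "v \<in> verts G" "\<nexists>t. cops_force G k t (\<sigma> []) v"
  shows "\<not> (\<exists>j<k. \<sigma> [v] j = v \<and> (\<sigma> [] j, v) \<in> unprot G)"
    and "\<exists>w. (v, w) \<in> edges G \<and> (\<nexists>t. cops_force G k t (\<sigma> [v]) w)"
proof -
  note first = legal_from_first[OF assms(1,2)]
  show "\<not> (\<exists>j<k. \<sigma> [v] j = v \<and> (\<sigma> [] j, v) \<in> unprot G)"
    using assms(3) first by (metis cops_force.simps(2))
  show "\<exists>w. (v, w) \<in> edges G \<and> (\<nexists>t. cops_force G k t (\<sigma> [v]) w)"
  proof (rule ccontr)
    assume "\<not> ?thesis"
    moreover have "finite {w. (v, w) \<in> edges G}"
      using digraph by (auto intro: finite_subset[of _ "verts G"] simp: protected_digraph_def)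
    ultimately obtain t where "\<And>w. w \<in> {w. (v, w) \<in> edges G} \<Longrightarrow> cops_force G k t (\<sigma> [v]) w"
      using uniform_bound[of "{w. (v, w) \<in> edges G}" k "\<sigma> [v]"] by auto
    then have "cops_force G k (Suc t) (\<sigma> []) v"
      using first by auto
    then show False
      using assms(3) by blast
  qed
qed

text \<open>Otherwise the robber can move forever through positions that are not won in any bounded
  time, and this infinite walk is never captured.\<close>

lemma winning_strategy_imp_cops_force:
  assumes "legal_from G k \<sigma> v" "v \<in> verts G"
    "\<And>r. robber_walk G r \<Longrightarrow> \<exists>n. capture_at G k \<sigma> r n"
  shows "\<exists>t. cops_force G k t (\<sigma> []) v"
proof (rule ccontr)
  assume not: "\<nexists>t. cops_force G k t (\<sigma> []) v"
  \<comment> \<open>The states are pairs of the strategy that remains after the history so far and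
    the robber's vertex.\<close>
  define P where "P = (\<lambda>(\<tau>, u). legal_from G k \<tau> u \<and> u \<in> verts G \<and>
    (\<nexists>t. cops_force G k t (\<tau> []) u))"
  define Q where "Q = (\<lambda>(\<tau> :: 'a strategy, u) (\<tau>' :: 'a strategy, w). (u, w) \<in> edges G \<and> \<tau>' = (\<lambda>h. \<tau> (u # h)))"
  have step: "\<exists>y. P y \<and> Q x y" if x: "P x" for x
  proof -
    obtain \<tau> u where [simp]: "x = (\<tau>, u)" by (cases x)
    have u: "legal_from G k \<tau> u" "u \<in> verts G" "\<nexists>t. cops_force G k t (\<tau> []) u"
      using x by (auto simp: P_def)
    obtain w where "(u, w) \<in> edges G" "\<nexists>t. cops_force G k t (\<tau> [u]) w"
      using legal_not_force_step(2)[OF u] by blast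
    then show ?thesis
      using legal_from_tail[OF u(1) _ legal_not_force_step(1)[OF u]] edge_verts
      by (intro exI[of _ "(\<lambda>h. \<tau> (u # h), w)"]) (auto simp: P_def Q_def)
  qed
  have "P (\<sigma>, v)"
    using assms not by (auto simp: P_def)
  then obtain f where f: "f 0 = (\<sigma>, v)" "\<And>n. P (f n)" "\<And>n. Q (f n) (f (Suc n))"
    using dependent_nat_choice[of "\<lambda>n x. P x \<and> (n = 0 \<longrightarrow> x = (\<sigma>, v))" "\<lambda>_. Q"] step by auto
  define r where "r n = snd (f n)" for n
  have f_Suc: "fst (f (Suc n)) = (\<lambda>h. fst (f n) (r n # h))" "(r n, r (Suc n)) \<in> edges G" for n
    using f(3)[of n] by (auto simp: Q_def r_def split: prod.splits)
  have walk: "robber_walk G r"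
    using assms(2) f(1) f_Suc(2) by (simp add: robber_walk_def r_def)
  \<comment> \<open>This recovers \<open>\<sigma>\<close>: after \<open>n\<close> rounds, the
    remaining strategy is \<open>\<sigma>\<close> with the first \<open>n\<close> robber positions
    prefixed.\<close>
  have history: "fst (f n) h = \<sigma> (map r [0..<n] @ h)" for n h
    by (induction n arbitrary: h) (simp_all add: f(1) f_Suc)
  have "\<not> capture_at G k \<sigma> r n" for n
  proof -
    have "P (fst (f n), r n)"
      using f(2) by (simp add: r_def)
    then have "\<not> (\<exists>j<k. fst (f n) [r n] j = r n \<and> (fst (f n) [] j, r n) \<in> unprot G)"
      unfolding P_def using legal_not_force_step(1) by blast
    then show ?thesis
      by (simp add: capture_at_def cops_at_def history)
  qed
  then show False
    using assms(3) walk by blast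
qed

lemma cops_win_iff: "cops_win G k \<longleftrightarrow> (\<exists>t. cops_win_within G k t)"
proof
  assume "cops_win G k"
  then obtain \<sigma> where \<sigma>: "legal_strategy G k \<sigma>"
    "\<And>r. robber_walk G r \<Longrightarrow> \<exists>n. capture_at G k \<sigma> r n"
    unfolding cops_win_def by blast
  then have "\<exists>t. cops_force G k t (\<sigma> []) r" if "r \<in> verts G" for r
    using that by (intro winning_strategy_imp_cops_force) (auto simp: legal_strategy_iff)
  moreover have "finite (verts G)"
    using digraph by (simp add: protected_digraph_def)
  ultimately obtain t where "\<And>r. r \<in> verts G \<Longrightarrow> cops_force G k t (\<sigma> []) r"
    using uniform_bound by metis
  then show "\<exists>t. cops_win_within G k t"
    using \<sigma>(1) by (auto simp: cops_win_within_iff legal_strategy_iff)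
next
  assume "\<exists>t. cops_win_within G k t"
  then show "cops_win G k"
    unfolding cops_win_def cops_win_within_def by blast
qed

end

section \<open>Adjacency in \<open>H\<close>\<close>

lemma unprot_H: "unprot (H_graph G k) = H_unprot_base G k \<union> (H_unprot_base G k)\<inverse>"
  and prot_H: "prot (H_graph G k) = H_prot_base G k \<union> (H_prot_base G k)\<inverse>"
  and verts_H [simp]: "verts (H_graph G k) = H_verts G k"
  by (simp_all add: H_graph_def)

lemma unprot_H_sym: "(x, y) \<in> unprot (H_graph G k) \<longleftrightarrow> (y, x) \<in> unprot (H_graph G k)"
  by (auto simp: unprot_H)

lemma mod3_cases: "i < (3 :: nat) \<Longrightarrow> i = 0 \<or> i = 1 \<or> i = 2"
  by auto

lemma H_vert_simps [simp]:
  "SV l \<in> H_verts G k \<longleftrightarrow> l < 4 * k"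
  "TV i j \<in> H_verts G k \<longleftrightarrow> i < 3 \<and> j < k"
  "Kappa v i j \<in> H_verts G k \<longleftrightarrow> v \<in> verts G \<and> i < 3 \<and> j < k"
  "Rho v i \<in> H_verts G k \<longleftrightarrow> v \<in> verts G \<and> i < 3"
  "CStar j \<in> H_verts G k \<longleftrightarrow> j < k"
  "RStar i \<in> H_verts G k \<longleftrightarrow> i < 3"
  by (auto simp: H_set_defs)

lemma reset_clique_simps [simp]:
  "SV l \<in> reset_clique k \<longleftrightarrow> l < 4 * k"
  "TV i j \<in> reset_clique k \<longleftrightarrow> i < 3 \<and> j < k"
  "Kappa v i j \<notin> reset_clique k"
  "Rho v i \<notin> reset_clique k"
  "CStar j \<notin> reset_clique k"
  "RStar i \<notin> reset_clique k"
  by (auto simp: H_set_defs)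

lemma block_offsets: "{0, 1, 2, 3 :: nat} = {..<4}" "{3, 4, 5, 6 :: nat} = (+) 3 ` {..<4}"
  by auto

text \<open>The offset 3 puts \<open>C*\<close> on a par with the indices 0, 1, 2 of the
  \<open>C_i\<close>: the attacked part of \<open>S\<close> is always an interval of length 4, and
  its offset names the class of the attacker.\<close>

lemma unprot_SV_iff:
  "(x, SV l) \<in> unprot (H_graph G k) \<longleftrightarrow>
     (\<exists>v i j d. x = Kappa v i j \<and> v \<in> verts G \<and> i < 3 \<and> j < k \<and> d < 4 \<and>
        l = (4 * j + i + d) mod (4 * k)) \<or>
     (\<exists>j d. x = CStar j \<and> j < k \<and> d < 4 \<and> l = (4 * j + 3 + d) mod (4 * k))"
  unfolding unprot_H H_unprot_base_def block_offsets
  by (cases x) (auto simp: H_set_defs add.assoc)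

lemma unprot_TV_iff:
  "(x, TV i j) \<in> unprot (H_graph G k) \<longleftrightarrow>
     i < 3 \<and> j < k \<and> ((\<exists>v \<in> verts G. x = Kappa v i j) \<or> x = CStar j)"
  by (cases x) (auto simp: unprot_H H_unprot_base_def H_set_defs)

lemma unprot_RStar_iff:
  "(x, RStar i) \<in> unprot (H_graph G k) \<longleftrightarrow>
     i < 3 \<and> ((\<exists>v m j. x = Kappa v m j \<and> v \<in> verts G \<and> m < 3 \<and> j < k) \<or> x = RStar i \<or>
       (\<exists>v \<in> verts G. x = Rho v ((i + 1) mod 3)))"
  by (cases x) (auto simp: unprot_H H_unprot_base_def H_set_defs)

lemma unprot_Kappa_Rho_iff:
  "(Kappa u i j, Rho v m) \<in> unprot (H_graph G k) \<longleftrightarrow>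
     i < 3 \<and> j < k \<and> ((u, v) \<in> unprot G \<and> m = (i + 1) mod 3 \<or>
       u \<in> verts G \<and> v \<in> verts G \<and> m < 3 \<and> (m = i \<or> m = (i + 2) mod 3))"
  unfolding unprot_H H_unprot_base_def by (auto simp: H_set_defs)

lemma unprot_CStar_Rho_iff:
  "(CStar j, Rho v m) \<in> unprot (H_graph G k) \<longleftrightarrow> j < k \<and> v \<in> verts G \<and> m < 3"
  unfolding unprot_H H_unprot_base_def by (auto simp: H_set_defs)

lemma unprot_CStar_Kappa_iff:
  "(CStar l, Kappa v i j) \<in> unprot (H_graph G k) \<longleftrightarrow> l < k \<and> v \<in> verts G \<and> i < 3 \<and> j < k"
  unfolding unprot_H H_unprot_base_def by (auto simp: H_set_defs)

lemma unprot_CStar_CStar_iff: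
  "(CStar l, CStar j) \<in> unprot (H_graph G k) \<longleftrightarrow> l = j \<and> j < k"
  unfolding unprot_H H_unprot_base_def by (auto simp: H_set_defs)

lemma unprot_Rho_Rho_iff:
  "(Rho u i, Rho v m) \<in> unprot (H_graph G k) \<longleftrightarrow> i < 3 \<and> m < 3 \<and>
     (u = v \<and> i = m \<and> u \<in> verts G \<or>
      m = (i + 1) mod 3 \<and> (u, v) \<in> edges G \<or> i = (m + 1) mod 3 \<and> (v, u) \<in> edges G)"
  unfolding unprot_H H_unprot_base_def by (auto simp: H_set_defs)

lemma unprot_Kappa_Kappa_iff:
  "(Kappa u i j, Kappa v m l) \<in> unprot (H_graph G k) \<longleftrightarrow> i < 3 \<and> m < 3 \<and> j < k \<and> l < k \<and>
     (u = v \<and> i = m \<and> u \<in> verts G \<or>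
      j = l \<and> (m = (i + 1) mod 3 \<and> (u, v) \<in> edges G \<or> i = (m + 1) mod 3 \<and> (v, u) \<in> edges G))"
  unfolding unprot_H H_unprot_base_def by (auto simp: H_set_defs)


lemma prot_Kappa_CStar [simp]:
  "(Kappa v i j, y) \<notin> prot (H_graph G k)" "(y, Kappa v i j) \<notin> prot (H_graph G k)"
  "(CStar j, y) \<notin> prot (H_graph G k)" "(y, CStar j) \<notin> prot (H_graph G k)"
  unfolding prot_H H_prot_base_def by (cases y; auto simp: H_set_defs)+

lemma prot_Rho_iff:
  "(Rho v i, SV l) \<in> prot (H_graph G k) \<longleftrightarrow> v \<in> verts G \<and> i < 3 \<and> l < 4 * k"
  "(Rho v i, TV m j) \<in> prot (H_graph G k) \<longleftrightarrow> v \<in> verts G \<and> i < 3 \<and> m = i \<and> j < k"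
  "(Rho v i, Rho u m) \<notin> prot (H_graph G k)"
  "(Rho v i, RStar m) \<notin> prot (H_graph G k)"
  unfolding prot_H H_prot_base_def by (auto simp: H_set_defs)

lemma prot_RStar_iff:
  "(RStar i, SV l) \<in> prot (H_graph G k) \<longleftrightarrow> i < 3 \<and> l < 4 * k"
  "(RStar i, TV m j) \<in> prot (H_graph G k) \<longleftrightarrow> i < 3 \<and> m = i \<and> j < k"
  "(RStar i, Rho v m) \<notin> prot (H_graph G k)"
  "(RStar i, RStar m) \<in> prot (H_graph G k) \<longleftrightarrow> i < 3 \<and> m < 3 \<and> i \<noteq> m"
  unfolding prot_H H_prot_base_def by (auto simp: H_set_defs)

lemma prot_sym: "(x, y) \<in> prot (H_graph G k) \<longleftrightarrow> (y, x) \<in> prot (H_graph G k)"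
  by (auto simp: prot_H)

lemma prot_reset_clique:
  "x \<in> reset_clique k \<Longrightarrow> y \<in> reset_clique k \<Longrightarrow> (x, y) \<in> prot (H_graph G k)"
  by (simp add: prot_H H_prot_base_def)

section \<open>Covering \<open>S\<close>\<close>

text \<open>Subtract \<open>s\<close> modulo \<open>4 * k\<close>, as the addition of
  \<open>4 * k - s\<close>, and divide by 4. Hence \<open>k\<close> intervals with a common offset,
  one per block, cover the cycle.\<close>

lemma block_exists:
  fixes p k s :: nat
  assumes "p < 4 * k" "s \<le> 4"
  obtains j d where "j < k" "d < 4" "p = (4 * j + s + d) mod (4 * k)"
proof -
  define q where "q = (p + (4 * k - s)) mod (4 * k)"
  have "q < 4 * k"
    using assms(1) by (simp add: q_def)
  then have "q div 4 < k"
    by (simp add: less_mult_imp_div_less mult.commute)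
  moreover have "(4 * (q div 4) + s + q mod 4) mod (4 * k) = (q + s) mod (4 * k)"
    by (simp add: ac_simps)
  moreover have "(q + s) mod (4 * k) = (p + (4 * k - s) + s) mod (4 * k)"
    by (simp add: q_def mod_add_left_eq)
  moreover have "0 < k"
    using assms(1) by simp
  then have "p + (4 * k - s) + s = p + 4 * k"
    using assms(2) by linarith
  ultimately show thesis
    using that[of "q div 4" "q mod 4"] assms(1) by simp
qed

text \<open>The interval starting at offset \<open>a\<close> of block \<open>j\<close> contains one
  point of residue \<open>r\<close>: it lies in block \<open>j\<close> if \<open>a \<le> r\<close>,
  and has spilled over into the next block otherwise.\<close>

lemma residue_block_cover:
  fixes k :: nat
  assumes "j < k" "m < k" "a < 4" "r < 4" "d < 4"
    and eq: "4 * m + r = (4 * j + a + d) mod (4 * k)"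
  shows "(j + (if r < a then 1 else 0)) mod k = m"
proof (cases "4 * j + a + d < 4 * k")
  case True
  then have *: "4 * m + r = 4 * j + a + d"
    using eq by simp
  then show ?thesis
  proof (cases "r < a")
    case True
    then have "j + 1 = m"
      using * assms(3-5) by linarith
    then show ?thesis
      using True assms(2) by simp
  next
    case False
    then have "j = m"
      using * assms(3-5) by linarith
    then show ?thesis
      using False assms(2) by simp
  qed
next
  case False
  then have "(4 * j + a + d) mod (4 * k) = 4 * j + a + d - 4 * k"
    using assms(1,3,5) by (subst le_mod_geq) auto
  then have *: "4 * m + r + 4 * k = 4 * j + a + d"
    using False eq by simp
  have "j + 1 = m + k" "r < a"
    using * assms(1,3-5) by linarith+
  then have "(j + (if r < a then 1 else 0)) mod k = (m + k) mod k"
    by simp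
  then show ?thesis
    using assms(2) by simp
qed

text \<open>
  \<open>k\<close> intervals of length 4 cover a cycle of length \<open>4 k\<close> only if they tile it, so all of them
  have the same offset modulo 4. For each residue \<open>r\<close> an interval contains one point congruent
  to \<open>r\<close>, and the map from intervals to these points, whose index is \<open>f r\<close> below, is bijective.
\<close>

lemma cyclic_interval_cover:
  fixes a j :: "nat \<Rightarrow> nat"
  assumes cover: "\<And>p. p < 4 * k \<Longrightarrow> \<exists>l\<in>A. \<exists>d<4. p = (4 * j l + a l + d) mod (4 * k)"
    and "A \<subseteq> {..<k'}" "k' \<le> k"
    and bounds: "\<And>l. l \<in> A \<Longrightarrow> j l < k \<and> a l < 4"
  shows "k' = k" "A = {..<k}" "\<And>l l'. l \<in> A \<Longrightarrow> l' \<in> A \<Longrightarrow> a l = a l'"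
proof -
  define f where "f r l = (j l + (if r < a l then 1 else 0)) mod k" for r l
  have finite: "finite A"
    using assms(2) finite_subset by blast
  have surj: "{..<k} \<subseteq> f r ` A" if "r < 4" for r
  proof
    fix m assume "m \<in> {..<k}"
    then have m: "m < k" by simp
    then have "4 * m + r < 4 * k"
      using that by linarith
    then obtain l d where l: "l \<in> A" "d < 4" "4 * m + r = (4 * j l + a l + d) mod (4 * k)"
      using cover[of "4 * m + r"] by blast
    then have "f r l = m"
      unfolding f_def using residue_block_cover[OF _ m _ that l(2,3)] bounds by blast
    then show "m \<in> f r ` A"
      using l(1) by blast
  qed
  have "k \<le> card A"
    using surj_card_le[OF finite surj, of 0] by simp
  moreover have "card A \<le> k'"
    using card_mono[OF _ assms(2)] by simp
  ultimately show "k' = k"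
    using assms(3) by simp
  then show A: "A = {..<k}"
    using assms(2) \<open>k \<le> card A\<close> by (intro card_seteq) auto
  have inj: "inj_on (f r) A" if "r < 4" for r
  proof (rule eq_card_imp_inj_on[OF finite])
    have "k \<le> card (f r ` A)"
      using card_mono[OF _ surj[OF that]] finite by simp
    then show "card (f r ` A) = card A"
      using card_image_le[OF finite, of "f r"] A by simp
  qed
  \<comment> \<open>No offset exceeds 3, so the point of residue 3 lies in the interval's own block.
    By \<open>surj\<close> and \<open>inj\<close> for \<open>r = 3\<close>, exactly one interval
    starts in each block.\<close>
  have f3: "f 3 l = j l" if "l \<in> A" for l
    using bounds[OF that] by (simp add: f_def)
  \<comment> \<open>An interval with \<open>r < a l\<close> takes the point of residue
    \<open>r\<close> in the next block. An interval starting there with offset at most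
    \<open>r\<close> would take the same point, against \<open>inj\<close>.\<close>
  have step: "r < a l'" if "r < 3" "l \<in> A" "r < a l" "l' \<in> A" "j l' = (j l + 1) mod k" for r l l'
  proof (rule ccontr)
    assume "\<not> r < a l'"
    then have "f r l' = f r l"
      using that by (simp add: f_def)
    then have "l' = l"
      using inj[of r] that by (auto dest: inj_onD)
    then show False
      using \<open>\<not> r < a l'\<close> that(3) by simp
  qed
  \<comment> \<open>Hence having an offset above \<open>r\<close> spreads around the cycle, block by
    block.\<close>
  have reach: "\<exists>l'\<in>A. j l' = (j l + n) mod k \<and> r < a l'" if "r < 3" "l \<in> A" "r < a l" for r l n
  proof (induction n)
    case 0
    then show ?case
      using that bounds[of l] by (intro bexI[of _ l]) auto
  next
    case (Suc n)
    then obtain l' where l': "l' \<in> A" "j l' = (j l + n) mod k" "r < a l'"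
      by blast
    have "(j l + Suc n) mod k \<in> {..<k}"
      using bounds[OF that(2)] by simp
    then obtain l'' where l'': "l'' \<in> A" "f 3 l'' = (j l + Suc n) mod k"
      using surj[of 3] by fastforce
    moreover have "j l'' = (j l' + 1) mod k"
      using l'' l'(2) f3 by (simp add: mod_Suc_eq)
    ultimately show ?case
      using step[OF that(1) l'(1,3)] f3 by metis
  qed
  have less: "r < a l'" if "r < 3" "l \<in> A" "r < a l" "l' \<in> A" for r l l'
  proof -
    have "j l < k" "j l' < k"
      using bounds that by auto
    \<comment> \<open>The number of steps around the cycle from block \<open>j l\<close> to block
      \<open>j l'\<close>.\<close>
    then have "(j l + (k - j l + j l')) mod k = j l'"
      by simp
    then obtain l'' where l'': "l'' \<in> A" "j l'' = j l'" "r < a l''"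
      using reach[OF \<open>r < 3\<close> \<open>l \<in> A\<close> \<open>r < a l\<close>] by metis
    then have "f 3 l'' = f 3 l'"
      using f3 that(4) by simp
    then have "l'' = l'"
      using inj[of 3] l''(1) that(4) by (auto dest: inj_onD)
    then show ?thesis
      using l''(3) by simp
  qed
  show "a l = a l'" if "l \<in> A" "l' \<in> A" for l l'
  proof -
    \<comment> \<open>With \<open>r = a l1\<close>, the fact \<open>less\<close> would turn
      \<open>a l1 < a l2\<close> into \<open>a l1 < a l1\<close>.\<close>
    have "\<not> a l1 < a l2" if "l1 \<in> A" "l2 \<in> A" for l1 l2
    proof
      assume "a l1 < a l2"
      moreover from this have "a l1 < 3"
        using bounds[OF \<open>l2 \<in> A\<close>] by simp
      ultimately show False
        using less[of "a l1" l2 l1] that by simp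
    qed
    then show ?thesis
      using that by (meson linorder_neqE_nat)
  qed
qed

lemma S_cover:
  assumes "\<And>p. p < 4 * k \<Longrightarrow> \<exists>l<k'. (c l, SV p) \<in> unprot (H_graph G k)" "k' \<le> k"
  shows "k' = k"
    and "(\<exists>i<3. \<forall>l<k. \<exists>v\<in>verts G. \<exists>j<k. c l = Kappa v i j) \<or> (\<forall>l<k. \<exists>j<k. c l = CStar j)"
proof -
  \<comment> \<open>The value 3 is the true offset for \<open>CStar\<close>; the other vertices that
    receive it do not attack \<open>S\<close> and are kept out of \<open>A\<close>.\<close>
  define a where "a l = (case c l of Kappa v i j \<Rightarrow> i | _ \<Rightarrow> 3)" for l
  define b where "b l = (case c l of Kappa v i j \<Rightarrow> j | CStar j \<Rightarrow> j | _ \<Rightarrow> 0)" for l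
  define A where "A = {l. l < k' \<and>
    ((\<exists>v\<in>verts G. \<exists>i<3. \<exists>j<k. c l = Kappa v i j) \<or> (\<exists>j<k. c l = CStar j))}"
  have cover: "\<exists>l\<in>A. \<exists>d<4. p = (4 * b l + a l + d) mod (4 * k)" if p: "p < 4 * k" for p
  proof -
    obtain l where l: "l < k'" "(c l, SV p) \<in> unprot (H_graph G k)"
      using assms(1)[OF p] by blast
    from l(2) consider (1) v i j d where "c l = Kappa v i j" "v \<in> verts G" "i < 3" "j < k" "d < 4"
        "p = (4 * j + i + d) mod (4 * k)"
      | (2) j d where "c l = CStar j" "j < k" "d < 4" "p = (4 * j + 3 + d) mod (4 * k)"
      unfolding unprot_SV_iff by blast
    then show ?thesis
    proof cases
      case 1
      then have "l \<in> A"
        using l(1) unfolding A_def by blast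
      then show ?thesis
        using 1 by (intro bexI[of _ l] exI[of _ d]) (simp_all add: a_def b_def)
    next
      case 2
      then have "l \<in> A"
        using l(1) unfolding A_def by blast
      then show ?thesis
        using 2 by (intro bexI[of _ l] exI[of _ d]) (simp_all add: a_def b_def)
    qed
  qed
  have bounds: "b l < k \<and> a l < 4" if "l \<in> A" for l
    using that by (auto simp: A_def a_def b_def)
  have "A \<subseteq> {..<k'}"
    by (auto simp: A_def)
  note tiling = cyclic_interval_cover[of k A b a, OF cover this assms(2) bounds]
  have "k' = k"
    by (rule tiling(1))
  have A: "A = {..<k}"
    by (rule tiling(2))
  have offset: "a l = a l'" if "l < k" "l' < k" for l l'
    by (rule tiling(3)) (use that A in auto)
  show "k' = k"
    by fact
  have in_A: "(\<exists>v\<in>verts G. \<exists>i<3. \<exists>j<k. c l = Kappa v i j) \<or> (\<exists>j<k. c l = CStar j)"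
    if "l < k" for l
    using that A by (auto simp: A_def)
  show "(\<exists>i<3. \<forall>l<k. \<exists>v\<in>verts G. \<exists>j<k. c l = Kappa v i j) \<or> (\<forall>l<k. \<exists>j<k. c l = CStar j)"
  proof (cases "\<forall>l<k. a l = 3")
    case True
    have "\<exists>j<k. c l = CStar j" if "l < k" for l
    proof -
      have "a l = 3"
        using True that by blast
      then show ?thesis
        using in_A[OF that] by (auto simp: a_def)
    qed
    then show ?thesis
      by blast
  next
    case False
    then obtain l where l: "l < k" "a l \<noteq> 3"
      by blast
    have a: "a l' = a l" if "l' < k" for l'
      using that l(1) by (rule offset)
    have "\<exists>v\<in>verts G. \<exists>j<k. c l' = Kappa v (a l) j \<and> a l < 3" if "l' < k" for l'
    proof -
      have "a l' \<noteq> 3"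
        using a[OF that] l(2) by simp
      then have "\<exists>v\<in>verts G. \<exists>j<k. c l' = Kappa v (a l') j \<and> a l' < 3"
        using in_A[OF that] by (auto simp: a_def)
      then show ?thesis
        unfolding a[OF that] .
    qed
    then have "a l < 3" "\<forall>l'<k. \<exists>v\<in>verts G. \<exists>j<k. c l' = Kappa v (a l) j"
      using l(1) by blast+
    then show ?thesis
      by blast
  qed
qed

section \<open>The games on \<open>G\<close> and \<open>H\<close>\<close>

declare cops_force.simps(2) [simp del]

locale reset_construction = endless_graph G for G :: "'a pgraph" +
  fixes k :: nat
  assumes in_neighbour: "v \<in> verts G \<Longrightarrow> \<exists>u. (u, v) \<in> edges G"
    and two_cops: "k \<ge> 2"
begin

abbreviation "H \<equiv> H_graph G k"

lemma loop_H: "x \<in> H_verts G k \<Longrightarrow> (x, x) \<in> edges H"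
  using reflexive_H_graph[of G k] by (simp add: reflexive_def)

sublocale H: endless_graph H
proof
  show "protected_digraph H"
    by (rule protected_digraph_H_graph) (rule digraph)
qed (use loop_H in auto)

lemma unprot_edges: "(x, y) \<in> unprot H \<Longrightarrow> (x, y) \<in> edges H"
  and prot_edges: "(x, y) \<in> prot H \<Longrightarrow> (x, y) \<in> edges H"
  by (simp_all add: edges_def)

section \<open>Upper bound: the play of \<open>k\<close> cops on \<open>H\<close>\<close>

lemma H_capture:
  assumes "l < k'" "(c l, r) \<in> unprot H" "\<And>l. l < k' \<Longrightarrow> c l \<in> H_verts G k"
  shows "cops_force H k' (Suc t) c r"
  using assms(1,2) by (rule cops_force_capture) (use assms(3) loop_H in blast)

text \<open>Cop \<open>l\<close> uses index \<open>l\<close>, so the intervals tile \<open>S\<close>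
  and all of \<open>T_i\<close> is attacked. Only \<open>R_{i+1}\<close>, the classes
  \<open>C_m\<close> and the \<open>T_m\<close> with \<open>m \<noteq> i\<close> may contain safe
  vertices.\<close>

lemma Kappa_attacks:
  assumes v: "\<And>l. l < k \<Longrightarrow> v l \<in> verts G" and "i < 3"
  shows "p < 4 * k \<Longrightarrow> \<exists>l<k. (Kappa (v l) i l, SV p) \<in> unprot H"
    "j < k \<Longrightarrow> \<exists>l<k. (Kappa (v l) i l, TV i j) \<in> unprot H"
    "w \<in> verts G \<Longrightarrow> \<exists>l<k. (Kappa (v l) i l, Rho w i) \<in> unprot H"
    "w \<in> verts G \<Longrightarrow> \<exists>l<k. (Kappa (v l) i l, Rho w ((i + 2) mod 3)) \<in> unprot H"
    "j < k \<Longrightarrow> \<exists>l<k. (Kappa (v l) i l, CStar j) \<in> unprot H"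
    "m < 3 \<Longrightarrow> \<exists>l<k. (Kappa (v l) i l, RStar m) \<in> unprot H"
proof -
  have k: "0 < k"
    using two_cops by simp
  show "\<exists>l<k. (Kappa (v l) i l, SV p) \<in> unprot H" if p: "p < 4 * k"
  proof -
    obtain j d where "j < k" "d < 4" "p = (4 * j + i + d) mod (4 * k)"
      by (rule block_exists[OF p, of i]) (use assms(2) in auto)
    then show ?thesis
      using assms(2) v by (intro exI[of _ j]) (auto simp: unprot_SV_iff)
  qed
  show "\<exists>l<k. (Kappa (v l) i l, TV i j) \<in> unprot H" if "j < k"
    using that assms by (auto simp: unprot_TV_iff)
  show "\<exists>l<k. (Kappa (v l) i l, Rho w i) \<in> unprot H"
    "\<exists>l<k. (Kappa (v l) i l, Rho w ((i + 2) mod 3)) \<in> unprot H" if "w \<in> verts G"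
    using that assms k by (auto simp: unprot_Kappa_Rho_iff)
  show "\<exists>l<k. (Kappa (v l) i l, CStar j) \<in> unprot H" if "j < k"
    using that assms k by (auto simp: unprot_H_sym[of "Kappa _ _ _"] unprot_CStar_Kappa_iff)
  show "\<exists>l<k. (Kappa (v l) i l, RStar m) \<in> unprot H" if "m < 3"
    using that assms k by (auto simp: unprot_RStar_iff)
qed

text \<open>One cop on each \<open>c*_l\<close> yields \<open>k\<close> intervals of offset 3, which
  again tile \<open>S\<close>.\<close>

lemma CStar_attacks:
  assumes "x \<in> H_verts G k" "\<And>i. x \<noteq> RStar i"
  shows "\<exists>l<k. (CStar l, x) \<in> unprot H"
proof (cases x)
  case (SV p)
  then obtain j d where "j < k" "d < 4" "p = (4 * j + 3 + d) mod (4 * k)"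
    using block_exists[of p k 3 thesis] assms(1) by auto
  then show ?thesis
    unfolding SV by (intro exI[of _ j]) (auto simp: unprot_SV_iff)
qed (use assms two_cops in \<open>auto simp: unprot_TV_iff unprot_CStar_Kappa_iff unprot_CStar_Rho_iff
      unprot_CStar_CStar_iff intro!: exI[of _ 0]\<close>)

text \<open>
  A robber who enters some \<open>C_m\<close> is caught by two cops: the one with the robber's index follows
  him into \<open>C_m\<close>, and another one moves to \<open>C*\<close>.
\<close>

lemma Kappa_surrounded:
  assumes "y \<in> verts G" "l < k" "(Kappa x m j, z) \<in> edges H"
  shows "(Kappa y m j, z) \<in> unprot H \<or> (CStar l, z) \<in> unprot H"
proof -
  have z: "(z, Kappa x m j) \<in> unprot H"
    using assms(3) by (auto simp: edges_def unprot_H_sym[of z])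
  then have "Kappa x m j \<in> H_verts G k" "z \<in> H_verts G k"
    using H.edge_verts unprot_edges by fastforce+
  then show ?thesis
    using assms(1,2) z unprot_H_sym[of z]
    by (cases z) (auto simp: unprot_SV_iff unprot_TV_iff unprot_CStar_Kappa_iff unprot_CStar_Rho_iff
        unprot_RStar_iff unprot_H_sym[of "Kappa _ _ _" "CStar _"])
qed

text \<open>Modulo 3, any two indices are equal or consecutive. Stepping from \<open>C_i\<close> to
  \<open>C_{i-1}\<close> traverses an edge of \<open>G\<close> backwards, which is why in-neighbours
  are required.\<close>

lemma cop_follows:
  assumes "v \<in> verts G" "i < 3" "m < 3" "j < k"
  obtains y where "y \<in> verts G" "(Kappa v i j, Kappa y m j) \<in> unprot H"
proof -
  obtain u w where uw: "(u, v) \<in> edges G" "(v, w) \<in> edges G"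
    using assms(1) in_neighbour out_neighbour by blast
  have "m = i \<or> m = (i + 1) mod 3 \<or> i = (m + 1) mod 3"
    using assms(2,3) mod3_cases[of i] mod3_cases[of m] by auto
  then consider "m = i" | "m = (i + 1) mod 3" | "i = (m + 1) mod 3"
    by blast
  then show thesis
  proof cases
    case 1
    then show thesis
      using that[of v] assms by (simp add: unprot_Kappa_Kappa_iff)
  next
    case 2
    then show thesis
      using that[of w] assms uw edge_verts by (simp add: unprot_Kappa_Kappa_iff)
  next
    case 3
    then show thesis
      using that[of u] assms uw edge_verts by (simp add: unprot_Kappa_Kappa_iff)
  qed
qed

lemma cops_force_Kappa:
  assumes v: "\<And>l. l < k \<Longrightarrow> v l \<in> verts G" and "i < 3" "Kappa x m j \<in> H_verts G k" "2 \<le> t"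
  shows "cops_force H k t (\<lambda>l. Kappa (v l) i l) (Kappa x m j)"
proof -
  have xmj: "x \<in> verts G" "m < 3" "j < k"
    using assms(3) by simp_all
  obtain y where y: "y \<in> verts G" "(Kappa (v j) i j, Kappa y m j) \<in> unprot H"
    using cop_follows v assms(2) xmj(2,3) by metis
  \<comment> \<open>The cop who goes to \<open>C*\<close> must differ from the one who follows the
    robber, so two cops are required.\<close>
  obtain l where l: "l < k" "l \<noteq> j"
    using that[of "if j = 0 then 1 else 0"] two_cops by (simp split: if_splits)
  define c where "c = (\<lambda>l. Kappa (v l) i l)(j := Kappa y m j, l := CStar l)"
  have c_verts: "c n \<in> H_verts G k" if "n < k" for n
    using that v assms(2) y(1) xmj l(1) by (auto simp: c_def)
  have "(Kappa (v n) i n, c n) \<in> edges H" if "n < k" for n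
    using that v[OF that] assms(2) y(2) l loop_H[of "Kappa (v n) i n"]
    by (auto simp: c_def unprot_CStar_Kappa_iff unprot_H_sym[of "Kappa _ _ _" "CStar _"]
        intro: unprot_edges)
  moreover have "cops_force H k 1 c z" if "(Kappa x m j, z) \<in> edges H" for z
    using Kappa_surrounded[OF y(1) l(1) that] H_capture[of j k c z 0] H_capture[of l k c z 0]
      c_verts l xmj(3) by (auto simp: c_def)
  ultimately have "cops_force H k (Suc 1) (\<lambda>l. Kappa (v l) i l) (Kappa x m j)"
    unfolding cops_force.simps(2)[of _ _ 1] by blast
  then show ?thesis
    by (rule cops_force_mono[rotated]) (use assms(4) in simp)
qed

text \<open>The situation after a cop turn of the simulation, when the cops have caught up with the
  robber's index: unless he deviates into some \<open>C_m\<close>, his safe replies are moves of the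
  game on \<open>G\<close>.\<close>

lemma Rho_successor:
  assumes v: "\<And>l. l < k \<Longrightarrow> v l \<in> verts G" and "i < 3" "(Rho w i, z) \<in> edges H"
  obtains l where "l < k" "(Kappa (v l) i l, z) \<in> unprot H"
    | x m j where "z = Kappa x m j" | w' where "(w, w') \<in> edges G" "z = Rho w' ((i + 1) mod 3)"
proof -
  have verts: "Rho w i \<in> H_verts G k" "z \<in> H_verts G k"
    using H.edge_verts[OF assms(3)] by simp_all
  note attacks = Kappa_attacks[of v i, OF v assms(2)]
  show thesis
  proof (cases z)
    case (SV p)
    then show thesis
      using attacks(1) verts that(1) by auto
  next
    case (TV m j)
    then have "m = i"
      using assms(3) by (auto simp: edges_def prot_Rho_iff unprot_TV_iff)
    then show thesis
      using attacks(2) verts that(1) TV by auto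
  next
    case (Kappa x m j)
    then show thesis
      by (rule that(2))
  next
    case (Rho w' m)
    then consider "m = i" | "i = (m + 1) mod 3" | "m = (i + 1) mod 3 " "(w, w') \<in> edges G"
      using assms(3) by (auto simp: edges_def prot_Rho_iff unprot_Rho_Rho_iff)
    then show thesis
    proof cases
      case 1
      then show thesis
        using attacks(3) verts that(1) Rho by auto
    next
      case 2
      then have "m = (i + 2) mod 3"
        using verts Rho mod3_cases[of m] by auto
      then show thesis
        using attacks(4)[of w'] verts that(1) Rho by auto
    next
      case 3
      then show thesis
        using that(3) Rho by blast
    qed
  next
    case (CStar j)
    then show thesis
      using attacks(5) verts that(1) by auto
  next
    case (RStar m)
    then show thesis
      using attacks(6) verts that(1) by auto
  qed
qed

text \<open>The same analysis for the opening: the reply into \<open>R_{i+1}\<close> is the robber's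
  free choice of a starting vertex in \<open>G\<close>.\<close>

lemma RStar_successor:
  assumes v: "\<And>l. l < k \<Longrightarrow> v l \<in> verts G" and "(RStar i, z) \<in> edges H"
  obtains l where "l < k" "(Kappa (v l) i l, z) \<in> unprot H"
    | x m j where "z = Kappa x m j" | w where "w \<in> verts G" "z = Rho w ((i + 1) mod 3)"
proof -
  have verts: "i < 3" "z \<in> H_verts G k"
    using H.edge_verts[OF assms(2)] by simp_all
  note attacks = Kappa_attacks[of v i, OF v verts(1)]
  show thesis
  proof (cases z)
    case (SV p)
    then show thesis
      using attacks(1) verts that(1) by auto
  next
    case (TV m j)
    then have "m = i"
      using assms(2) by (auto simp: edges_def prot_RStar_iff unprot_TV_iff)
    then show thesis
      using attacks(2) verts that(1) TV by auto
  next
    case (Kappa x m j)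
    then show thesis
      by (rule that(2))
  next
    case (Rho w' m)
    then show thesis
      using assms(2) verts that(3)
      by (auto simp: edges_def prot_RStar_iff unprot_H_sym[of "RStar _" "Rho _ _"] unprot_RStar_iff)
  next
    case (CStar j)
    then show thesis
      using attacks(5) verts that(1) by auto
  next
    case (RStar m)
    then show thesis
      using attacks(6) verts that(1) by auto
  qed
qed

text \<open>Each round on \<open>G\<close> is copied with \<open>i\<close> advanced by one. The
  additional round pays for a detour into some \<open>C_m\<close>, which takes the cops two rounds
  to punish.\<close>

lemma cops_force_simulation:
  assumes "cops_force G k t v w" "\<And>l. l < k \<Longrightarrow> v l \<in> verts G" "w \<in> verts G" "i < 3"
  shows "cops_force H k (t + 1) (\<lambda>l. Kappa (v l) i l) (Rho w ((i + 1) mod 3))"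
  using assms
proof (induction t arbitrary: v w i)
  case (Suc t)
  let ?c = "\<lambda>v l. Kappa (v l) ((i + 1) mod 3) l"
  obtain v' where v': "\<And>l. l < k \<Longrightarrow> (v l, v' l) \<in> edges G"
    "(\<exists>j<k. v' j = w \<and> (v j, w) \<in> unprot G) \<or> (\<forall>w'. (w, w') \<in> edges G \<longrightarrow> cops_force G k t v' w')"
    using Suc.prems(1) by (auto simp: cops_force.simps(2))
  have v'_verts: "v' l \<in> verts G" if "l < k" for l
    using v'(1)[OF that] edge_verts by blast
  show ?case
  proof (cases "\<exists>l<k. (v l, w) \<in> unprot G")
    case True
    then obtain l where "l < k" "(Kappa (v l) i l, Rho w ((i + 1) mod 3)) \<in> unprot H"
      using Suc.prems(4) by (auto simp: unprot_Kappa_Rho_iff)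
    then show ?thesis
      using Suc.prems(2,4) H_capture[of l k "\<lambda>l. Kappa (v l) i l" _ "Suc t"] by simp
  next
    case False
    then have force: "\<And>w'. (w, w') \<in> edges G \<Longrightarrow> cops_force G k t v' w'"
      using v'(2) by blast
    \<comment> \<open>The robber has a reply and nothing is won in 0 rounds; hence the
      \<open>t + 1\<close> rounds left are at least the two that \<open>cops_force_Kappa\<close>
      asks for.\<close>
    then have t: "t \<noteq> 0"
      using out_neighbour[OF Suc.prems(3)] by (intro notI) auto
    have "cops_force H k (t + 1) (?c v') z" if z: "(Rho w ((i + 1) mod 3), z) \<in> edges H" for z
    proof (cases rule: Rho_successor[of v', OF v'_verts _ z])
      case (3 l)
      then show ?thesis
        using H_capture[of l k "?c v'" z t] v'_verts by simp
    next
      case (4 x m j)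
      then show ?thesis
        using H.edge_verts[OF z] cops_force_Kappa[of v', OF v'_verts] t by simp
    next
      case (5 w')
      then show ?thesis
        using Suc.IH[of v' w' "(i + 1) mod 3"] force v'_verts edge_verts by simp
    qed auto
    moreover have "(Kappa (v l) i l, ?c v' l) \<in> edges H" if "l < k" for l
      using that v'(1) Suc.prems(4) by (intro unprot_edges) (simp add: unprot_Kappa_Kappa_iff)
    ultimately show ?thesis
      by (auto intro!: exI[of _ "?c v'"] simp: cops_force.simps(2)[of _ _ "Suc t"])
  qed
qed simp

text \<open>Of the two additional rounds, one is the opening move from \<open>C*\<close> to the
  \<open>C_i\<close> that matches \<open>r*_i\<close>, the other is the allowance for a
  detour.\<close>

lemma cops_win_within_H:
  assumes "cops_win_within G k t"
  shows "cops_win_within H k (t + 2)"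
proof -
  obtain v where v: "\<And>l. l < k \<Longrightarrow> v l \<in> verts G" "\<And>w. w \<in> verts G \<Longrightarrow> cops_force G k t v w"
    using assms unfolding cops_win_within_iff by blast
  have "v 0 \<in> verts G"
    using v(1) two_cops by simp
  then have t: "t \<noteq> 0"
    using v(2) by (intro notI) auto
  have "cops_force H k (t + 2) CStar x" if x: "x \<in> H_verts G k" for x
  proof (cases "\<exists>i. x = RStar i")
    case True
    then obtain i where i: "x = RStar i" "i < 3"
      using x by auto
    let ?c = "\<lambda>l. Kappa (v l) i l"
    have "cops_force H k (t + 1) ?c z" if z: "(RStar i, z) \<in> edges H" for z
    proof (cases rule: RStar_successor[of v i, OF v(1) z])
      case (2 l)
      then show ?thesis
        using H_capture[of l k ?c z t] v(1) i(2) by simp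
    next
      case (3 x m j)
      then show ?thesis
        using H.edge_verts[OF z] cops_force_Kappa[of v, OF v(1)] t by simp
    next
      case (4 w)
      then show ?thesis
        using cops_force_simulation v i(2) by simp
    qed
    moreover have "(CStar l, ?c l) \<in> edges H" if "l < k" for l
      using that v(1) i(2) by (intro unprot_edges) (simp add: unprot_CStar_Kappa_iff)
    ultimately have "cops_force H k (Suc (t + 1)) CStar (RStar i)"
      by (auto intro!: exI[of _ ?c] simp: cops_force.simps(2)[of _ _ "Suc t"])
    then show ?thesis
      by (simp add: i(1))
  next
    case False
    then obtain l where "l < k" "(CStar l, x) \<in> unprot H"
      using CStar_attacks x by blast
    then show ?thesis
      using H_capture[of l k CStar x "Suc t"] by simp
  qed
  then show ?thesis
    unfolding H.cops_win_within_iff by (intro exI[of _ CStar]) simp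
qed

section \<open>Lower bounds: evasion of the robber on \<open>H\<close>\<close>

lemma reset_clique_edges:
  assumes "x \<in> reset_clique k \<or> (\<exists>w\<in>verts G. \<exists>i<3. x = Rho w i) \<or> (\<exists>i<3. x = RStar i)" "p < 4 * k"
  shows "(x, SV p) \<in> edges H"
  using assms by (auto simp: prot_reset_clique prot_Rho_iff prot_RStar_iff intro: prot_edges)

text \<open>Fewer than \<open>k\<close> cops never attack all of \<open>S\<close>, and
  \<open>S\<close> is a clique, so after each cop turn an unattacked point of \<open>S\<close> is
  within reach.\<close>

lemma robber_evades_few_cops:
  assumes "k' < k" "p < 4 * k" "\<And>l. l < k' \<Longrightarrow> (c l, SV p) \<notin> unprot H"
  shows "\<not> cops_force H k' t c (SV p)"
  using assms(2,3)
proof (induction t arbitrary: c p)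
  case (Suc t)
  show ?case
  proof
    assume "cops_force H k' (Suc t) c (SV p)"
    then obtain c' where c': "\<And>z. (SV p, z) \<in> edges H \<Longrightarrow> cops_force H k' t c' z"
      using Suc.prems(2) by (auto simp: cops_force.simps(2))
    obtain q where "q < 4 * k" "\<And>l. l < k' \<Longrightarrow> (c' l, SV q) \<notin> unprot H"
      using S_cover(1)[of k k' c' G] assms(1) by fastforce
    then show False
      using Suc.IH[of q c'] c' reset_clique_edges[of "SV p" q] Suc.prems(1) by simp
  qed
qed simp

lemma few_cops_lose:
  assumes "cops_win_within H k' t"
  shows "k \<le> k'"
proof (rule ccontr)
  assume "\<not> k \<le> k'"
  then have k': "k' < k" by simp
  obtain c where c: "\<And>r. r \<in> H_verts G k \<Longrightarrow> cops_force H k' t c r"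
    using assms unfolding H.cops_win_within_iff by auto
  obtain q where "q < 4 * k" "\<And>l. l < k' \<Longrightarrow> (c l, SV q) \<notin> unprot H"
    using S_cover(1)[of k k' c G] k' by fastforce
  then show False
    using robber_evades_few_cops[of k' q c] k' c[of "SV q"] by simp
qed

text \<open>If all replies lose, every point of \<open>S\<close> must be attacked, and
  \<open>S_cover\<close> leaves two placements. \<open>t^m_0\<close> serves as a test for
  \<open>T_m\<close>: cops in \<open>C_i\<close> leave it safe unless \<open>m = i\<close>. The
  assumption \<open>clique\<close> is to be the induction hypothesis of
  \<open>robber_evades\<close>.\<close>

lemma robber_evades_step:
  assumes "x \<in> reset_clique k \<or> (\<exists>w\<in>verts G. \<exists>i<3. x = Rho w i) \<or> (\<exists>i<3. x = RStar i)"
    and "\<And>z. (x, z) \<in> edges H \<Longrightarrow> cops_force H k t c z"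
    and clique: "\<And>c y. y \<in> reset_clique k \<Longrightarrow> (\<And>l. l < k \<Longrightarrow> (c l, y) \<notin> unprot H) \<Longrightarrow>
      \<not> cops_force H k t c y"
  obtains i v where "i < 3" "\<And>l. l < k \<Longrightarrow> v l \<in> verts G" "\<And>l. l < k \<Longrightarrow> \<exists>j<k. c l = Kappa (v l) i j"
      "\<And>m. m < 3 \<Longrightarrow> (x, TV m 0) \<in> edges H \<Longrightarrow> m = i"
    | "\<forall>l<k. \<exists>j<k. c l = CStar j"
proof -
  have "\<exists>l<k. (c l, SV p) \<in> unprot H" if "p < 4 * k" for p
    using clique[of "SV p" c] reset_clique_edges[OF assms(1) that] assms(2) that by auto
  from S_cover(2)[OF this order.refl] consider
    i where "i < 3" "\<forall>l<k. \<exists>v\<in>verts G. \<exists>j<k. c l = Kappa v i j" | "\<forall>l<k. \<exists>j<k. c l = CStar j"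
    by blast
  then show thesis
  proof cases
    case 1
    then obtain v where v: "\<And>l. l < k \<Longrightarrow> v l \<in> verts G" "\<And>l. l < k \<Longrightarrow> \<exists>j<k. c l = Kappa (v l) i j"
      by metis
    have "m = i" if m: "m < 3" "(x, TV m 0) \<in> edges H" for m
    proof (rule ccontr)
      assume "m \<noteq> i"
      then have "(c l, TV m 0) \<notin> unprot H" if "l < k" for l
        using v(2)[OF that] by (auto simp: unprot_TV_iff)
      then show False
        using clique[of "TV m 0" c] assms(2)[OF m(2)] m(1) two_cops by simp
    qed
    then show thesis
      using that(1) 1(1) v by blast
  qed (rule that(2))
qed

text \<open>
  The three invariants of the robber: he is unattacked in the reset clique, or all cops are in
  \<open>C*\<close> and he is in \<open>R*\<close>, or a game on \<open>G\<close> is simulated that he does not lose in time.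
\<close>

lemma robber_evades:
  assumes slow: "\<And>v. (\<And>l. l < k \<Longrightarrow> v l \<in> verts G) \<Longrightarrow> \<exists>w\<in>verts G. \<not> cops_force G k n v w"
    and "t \<le> Suc n"
  shows "y \<in> reset_clique k \<Longrightarrow> (\<And>l. l < k \<Longrightarrow> (c l, y) \<notin> unprot H) \<Longrightarrow> \<not> cops_force H k t c y"
    and "\<forall>l<k. \<exists>j<k. c l = CStar j \<Longrightarrow> i < 3 \<Longrightarrow> \<not> cops_force H k t c (RStar i)"
    and "(\<And>l. l < k \<Longrightarrow> v l \<in> verts G) \<Longrightarrow> (\<And>l. l < k \<Longrightarrow> \<exists>j<k. c l = Kappa (v l) i j) \<Longrightarrow>
      i < 3 \<Longrightarrow> w \<in> verts G \<Longrightarrow> \<not> cops_force G k t v w \<Longrightarrow>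
      \<not> cops_force H k t c (Rho w ((i + 1) mod 3))"
  using assms(2)
proof (induction t arbitrary: c y i v w)
  case (Suc t)
  {
    case 1
    show ?case
    proof
      assume "cops_force H k (Suc t) c y"
      then obtain c' where c': "\<And>z. (y, z) \<in> edges H \<Longrightarrow> cops_force H k t c' z"
        using 1(2) by (auto simp: cops_force.simps(2))
      show False
      proof (rule robber_evades_step[of y t c'])
        fix i assume "\<And>m. m < 3 \<Longrightarrow> (y, TV m 0) \<in> edges H \<Longrightarrow> m = i"
        then have "m = i" if "m < 3" for m
          using that two_cops 1(1) by (simp add: prot_edges prot_reset_clique)
        \<comment> \<open>From the clique both \<open>T_0\<close> and \<open>T_1\<close> are within
          reach, and cops in a single \<open>C_i\<close> cannot attack both.\<close>
        from this[of 0] this[of 1] show False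
          by simp
      next
        assume *: "\<forall>l<k. \<exists>j<k. c' l = CStar j"
        \<comment> \<open>Points of \<open>S\<close> are adjacent to all of \<open>R*\<close>, and
          points of \<open>T_i\<close> to \<open>r*_i\<close>.\<close>
        have "\<exists>i<3. (RStar i, y) \<in> prot H"
          using 1(1) by (cases y) (auto simp: prot_RStar_iff intro: exI[of _ 0])
        then obtain i where "i < 3" "(RStar i, y) \<in> prot H"
          by blast
        then have "cops_force H k t c' (RStar i)"
          by (intro c' prot_edges) (subst prot_sym)
        then show False
          using Suc.IH(2)[OF *] \<open>i < 3\<close> 1(3) by simp
      qed (use 1 c' Suc.IH(1) in auto)
    qed
  next
    case 2
    show ?case
    proof
      assume "cops_force H k (Suc t) c (RStar i)"
      moreover have "(c l, RStar i) \<notin> unprot H" if "l < k" for l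
        using 2(1) that by (auto simp: unprot_RStar_iff)
      ultimately obtain c' where c': "\<And>z. (RStar i, z) \<in> edges H \<Longrightarrow> cops_force H k t c' z"
        by (auto simp: cops_force.simps(2))
      show False
      proof (rule robber_evades_step[of "RStar i" t c'])
        fix i' v assume *: "i' < 3" "\<And>l. l < k \<Longrightarrow> v l \<in> verts G"
          "\<And>l. l < k \<Longrightarrow> \<exists>j<k. c' l = Kappa (v l) i' j"
          "\<And>m. m < 3 \<Longrightarrow> (RStar i, TV m 0) \<in> edges H \<Longrightarrow> m = i'"
        \<comment> \<open>\<open>T_i\<close> is adjacent to \<open>r*_i\<close>, so the cops must
          enter \<open>C_i\<close> itself.\<close>
        have [simp]: "i' = i"
          using *(4)[of i] 2(2) two_cops by (simp add: edges_def prot_RStar_iff)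
        \<comment> \<open>The cops' placement in \<open>C_i\<close> is read as their initial
          placement in \<open>G\<close>; \<open>w\<close> is the robber's answer. One round on
          \<open>H\<close> has been spent, so at most \<open>n\<close> remain.\<close>
        obtain w where w: "w \<in> verts G" "\<not> cops_force G k n v w"
          using slow *(2) by blast
        then have "\<not> cops_force G k t v w"
          using cops_force_mono 2(3) by (metis Suc_le_mono)
        moreover have "(RStar i, Rho w ((i + 1) mod 3)) \<in> edges H"
          using 2(2) w(1) by (intro unprot_edges)
            (auto simp: unprot_H_sym[of "RStar _" "Rho _ _"] unprot_RStar_iff)
        ultimately show False
          using Suc.IH(3)[of v c' i w] * w 2 c' by auto
      next
        assume *: "\<forall>l<k. \<exists>j<k. c' l = CStar j"
        \<comment> \<open>The cops are still in \<open>C*\<close>, so the robber waits by his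
          loop.\<close>
        show False
          using c'[OF loop_H] Suc.IH(2)[OF * 2(2)] 2 by simp
      qed (use 2 c' Suc.IH(1) in auto)
    qed
  next
    case 3
    show ?case
    proof
      assume "cops_force H k (Suc t) c (Rho w ((i + 1) mod 3))"
      moreover have "(c l, Rho w ((i + 1) mod 3)) \<notin> unprot H" if "l < k" for l
      proof
        assume "(c l, Rho w ((i + 1) mod 3)) \<in> unprot H"
        \<comment> \<open>\<open>i + 1\<close> is neither \<open>i\<close> nor \<open>i + 2\<close>
          modulo 3, so an attack from \<open>C_i\<close> on \<open>R_{i+1}\<close> can only come
          from an unprotected edge of \<open>G\<close>.\<close>
        then have "(v l, w) \<in> unprot G"
          using 3(2)[OF that] 3(3) mod3_cases[of i] by (auto simp: unprot_Kappa_Rho_iff)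
        then have "cops_force G k (Suc t) v w"
          by (rule cops_force_capture[OF that]) (use 3(1) out_neighbour in blast)
        then show False
          using 3(5) by blast
      qed
      ultimately obtain c' where c': "\<And>l. l < k \<Longrightarrow> (c l, c' l) \<in> edges H"
        "\<And>z. (Rho w ((i + 1) mod 3), z) \<in> edges H \<Longrightarrow> cops_force H k t c' z"
        by (auto simp: cops_force.simps(2))
      show False
      proof (rule robber_evades_step[of "Rho w ((i + 1) mod 3)" t c'])
        fix i' v' assume *: "i' < 3" "\<And>l. l < k \<Longrightarrow> v' l \<in> verts G"
          "\<And>l. l < k \<Longrightarrow> \<exists>j<k. c' l = Kappa (v' l) i' j"
          "\<And>m. m < 3 \<Longrightarrow> (Rho w ((i + 1) mod 3), TV m 0) \<in> edges H \<Longrightarrow> m = i'"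
        \<comment> \<open>The robber in \<open>R_{i+1}\<close> can reach \<open>T_{i+1}\<close>, so
          the cops have to advance to \<open>C_{i+1}\<close>.\<close>
        have i': "i' = (i + 1) mod 3"
          using *(4)[of "(i + 1) mod 3"] 3(4) two_cops by (simp add: edges_def prot_Rho_iff)
        \<comment> \<open>Advancing from \<open>C_i\<close> to \<open>C_{i+1}\<close> traverses an
          edge of \<open>G\<close> forwards, so the cop turn is a legal one on
          \<open>G\<close>.\<close>
        have "(v l, v' l) \<in> edges G" if "l < k" for l
          using c'(1)[OF that] 3(2)[OF that] *(3)[OF that] 3(3) mod3_cases[of i]
          by (auto simp: edges_def[of H] unprot_Kappa_Kappa_iff i')
        then obtain w' where w': "(w, w') \<in> edges G" "\<not> cops_force G k t v' w'"
          using 3(5) unfolding cops_force.simps(2) by blast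
        have "\<not> cops_force H k t c' (Rho w' ((i' + 1) mod 3))"
          by (rule Suc.IH(3)[OF *(2,3,1) _ w'(2)]) (use edge_verts[OF w'(1)] 3(6) in auto)
        moreover have "(Rho w ((i + 1) mod 3), Rho w' ((i' + 1) mod 3)) \<in> edges H"
          using w'(1) by (intro unprot_edges) (auto simp: unprot_Rho_Rho_iff i')
        ultimately show False
          using c'(2) by blast
      next
        assume *: "\<forall>l<k. \<exists>j<k. c' l = CStar j"
        have "(Rho w ((i + 1) mod 3), RStar i) \<in> edges H"
          using 3(3,4) by (intro unprot_edges) (auto simp: unprot_RStar_iff)
        then show False
          using c'(2) Suc.IH(2)[OF * 3(3)] 3 by simp
      qed (use 3 c' Suc.IH(1) in auto)
    qed
  }
qed simp_all

lemma cops_win_within_G: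
  assumes "cops_win_within H k t"
  obtains n where "t = Suc n" "cops_win_within G k n"
proof -
  obtain c where c: "\<And>r. r \<in> H_verts G k \<Longrightarrow> cops_force H k t c r"
    using assms unfolding H.cops_win_within_iff by auto
  have "RStar 0 \<in> H_verts G k"
    by simp
  then obtain n where n: "t = Suc n"
    using c[of "RStar 0"] by (cases t) auto
  have "cops_win_within G k n"
  proof (rule ccontr)
    assume "\<not> cops_win_within G k n"
    then have "\<exists>w\<in>verts G. \<not> cops_force G k n v w" if "\<And>l. l < k \<Longrightarrow> v l \<in> verts G" for v
      using that unfolding cops_win_within_iff by blast
    note evades = robber_evades[of n t, OF this]
    show False
    \<comment> \<open>The initial placement is treated like the result of a cop turn. The robber
      does not start on \<open>SV 0\<close>; it only stands for a clique vertex, and its neighbours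
      are among the starting vertices against which \<open>c\<close> wins.\<close>
    proof (rule robber_evades_step[of "SV 0" t c])
      fix i assume "\<And>m. m < 3 \<Longrightarrow> (SV 0, TV m 0) \<in> edges H \<Longrightarrow> m = i"
      then have "m = i" if "m < 3" for m
        using that two_cops by (simp add: prot_edges prot_reset_clique)
      from this[of 0] this[of 1] show False
        by simp
    next
      assume "\<forall>l<k. \<exists>j<k. c l = CStar j"
      then show False
        using evades(2)[of c 0] c[of "RStar 0"] n by simp
    qed (use c evades(1) n two_cops H.edge_verts in auto)
  qed
  then show thesis
    using that n by blast
qed

end

section \<open>Number of vertices, cop number and capture time\<close>

lemma card_H_verts:
  assumes "finite (verts G)"
  shows "card (H_verts G k) = (3 * k + 3) * card (verts G) + 8 * k + 3"
proof -
  let ?S = "SV ` {..<4 * k} :: 'a hvert set"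
  let ?T = "(\<lambda>(i, j). TV i j) ` ({..<3} \<times> {..<k}) :: 'a hvert set"
  let ?C = "(\<lambda>(v, i, j). Kappa v i j) ` (verts G \<times> {..<3} \<times> {..<k})"
  let ?R = "(\<lambda>(v, i). Rho v i) ` (verts G \<times> {..<3})"
  let ?C' = "CStar ` {..<k} :: 'a hvert set"
  let ?R' = "RStar ` {..<3} :: 'a hvert set"
  have "H_verts G k = ?S \<union> (?T \<union> (?C \<union> (?R \<union> (?C' \<union> ?R'))))"
  proof (rule set_eqI)
    show "x \<in> H_verts G k \<longleftrightarrow> x \<in> ?S \<union> (?T \<union> (?C \<union> (?R \<union> (?C' \<union> ?R'))))" for x
      by (cases x) (simp_all add: image_def Bex_def)
  qed
  moreover have "card \<dots> = card ?S + (card ?T + (card ?C + (card ?R + (card ?C' + card ?R'))))"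
    using assms by (subst card_Un_disjoint; auto)+
  moreover have "card ?S = 4 * k" "card ?T = 3 * k" "card ?C = card (verts G) * (3 * k)"
    "card ?R = card (verts G) * 3" "card ?C' = k" "card ?R' = 3"
    by (subst card_image; auto simp: inj_on_def card_cartesian_product)+
  ultimately show ?thesis
    by (simp add: algebra_simps)
qed

lemma cop_number_eqI:
  assumes "cops_win G k" "\<And>k'. cops_win G k' \<Longrightarrow> k \<le> k'"
  shows "cop_number G = enat k"
  unfolding cop_number_def using assms by (intro antisym INF_lower INF_greatest) auto

text \<open>A finite infimum excludes the empty set, whose infimum is \<open>\<infinity>\<close>,
  and is then attained by well-ordering.\<close>

lemma INF_enat_attained:
  assumes "(INF n\<in>A. enat n) = enat m"
  shows "m \<in> A"
proof -
  obtain n where "n \<in> A"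
    using assms by (cases "A = {}") (auto simp: top_enat_def)
  then have "(INF n\<in>A. enat n) \<in> enat ` A"
    by (intro wellorder_InfI[of "enat n"]) simp
  then show ?thesis
    using assms by auto
qed

theorem theorem4p5:
  fixes G :: "'a pgraph" and k :: nat
  assumes "protected_digraph G"
    and "k \<ge> 2"
    and "cop_number G = enat k"
    and "\<And>v. v \<in> verts G \<Longrightarrow> \<exists>u. (u, v) \<in> edges G"
    and "\<And>v. v \<in> verts G \<Longrightarrow> \<exists>w. (v, w) \<in> edges G"
  shows "cop_number (H_graph G k) = enat k
    \<and> capture_time G + 1 \<le> capture_time (H_graph G k)
    \<and> capture_time (H_graph G k) \<le> capture_time G + 2
    \<and> card (verts (H_graph G k)) = (3 * k + 3) * card (verts G) + 8 * k + 3"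
proof -
  interpret reset_construction G k
    by unfold_locales (use assms in auto)
  have "cops_win G k"
    using INF_enat_attained[of "{k. cops_win G k}" k] assms(3) by (simp add: cop_number_def)
  then have "cops_win H k"
    unfolding cops_win_iff H.cops_win_iff using cops_win_within_H by blast
  then have cop_number_H: "cop_number H = enat k"
    by (rule cop_number_eqI) (use few_cops_lose in \<open>auto simp: H.cops_win_iff\<close>)
  have "capture_time G + 1 \<le> enat t" if "cops_win_within H k t" for t
  proof -
    obtain n where n: "t = Suc n" "cops_win_within G k n"
      using cops_win_within_G \<open>cops_win_within H k t\<close> .
    then have "capture_time G \<le> enat n"
      unfolding capture_time_def assms(3) by (intro INF_lower) simp
    then have "capture_time G + 1 \<le> enat n + 1"
      by (rule add_right_mono)
    then show ?thesis
      by (simp add: n(1) one_enat_def)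
  qed
  then have "capture_time G + 1 \<le> capture_time H"
    unfolding capture_time_def[of H] cop_number_H by (intro INF_greatest) simp
  moreover have "capture_time H \<le> capture_time G + 2"
  proof (cases "capture_time G")
    case (enat t)
    then have "cops_win_within G k t"
      using INF_enat_attained[of "{t. cops_win_within G k t}" t] assms(3)
      by (simp add: capture_time_def)
    then have "cops_win_within H k (t + 2)"
      by (rule cops_win_within_H)
    then have "capture_time H \<le> enat (t + 2)"
      unfolding capture_time_def cop_number_H by (intro INF_lower) simp
    then show ?thesis
      by (simp add: enat numeral_eq_enat)
  qed simp
  moreover have "finite (verts G)"
    using assms(1) by (simp add: protected_digraph_def)
  ultimately show ?thesis
    using cop_number_H card_H_verts by simp
qed

end
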